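(* Assume that $F$ is strictly convex on $[0,a]$, strictly concave on $[a,1]$ and satisfies $$\int_0^1 F(s)\,ds > 0 .$$ Define $$m^*_0 := \frac{g}{\max_{s\in[a,1]} \frac{F(s)}{s}} .$$ Let $0<\alpha<\beta$ and suppose that $n(\cdot)$ is the $\beta$-periodic stepwise function given by $$n(t) := \begin{cases} n_1, & 0\le t<\alpha,\\ n_0, & \alpha\le t<\beta,\end{cases}$$ with $0<n_0<n_1$. Let $\psi$ be the Poincaré map over the period $\beta$ of the planar system $v'=y,\ y'=gv-n(t)F(v)$. Then there exists $\omega^*>m^*_0$ such that for every $n_0$ and $n_1$ with $$0<n_0<m^*_0<\omega^*<n_1$$ there exists a compact set $\Lambda\subseteq\, ]a,1[\,\times\,]0,+\infty[$, invariant for $\psi$, for which $\psi|_\Lambda$ is semiconjugate, via a continuous surjection $h:\Lambda\to\{1,2\}^{\mathbb Z}$, to the two-sided Bernoulli shift on two symbols. Moreover, for each periodic sequence of two symbols $(i_k)_{k\in\mathbb Z}$ there is a point $z\in\Lambda$ which is periodic (for $\psi$) and such that $h(z)=(i_k)_{k\in\mathbb Z}$.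
   Context: Standing assumptions: $g>0$ is a constant, and $F:\mathbb R\to\mathbb R$ is a $C^1$ function for which there is $a\in\,]0,1[$ with $F(0)=F(a)=F(1)=0$, $F(s)<0$ for $0<s<a$ and for $s>1$, and $F(s)>0$ for $s<0$ and for $a<s<1$. The weight $n$ is extended to $\mathbb R$ by $\beta$-periodicity. Poincaré map: $\psi(z):=\zeta(\beta,z)$, where $\zeta(\cdot)=\zeta(\cdot,z)$ is the solution of $v'=y,\ y'=gv-n(t)F(v)$ with $\zeta(0)=z\in\mathbb R^2$; $\psi$ is defined on the set $D_\psi\subseteq\mathbb R^2$ of those $z$ for which this solution exists on $[0,\beta]$, and is a homeomorphism of $D_\psi$ onto its image. The two-sided Bernoulli shift on two symbols is the map $\sigma:\{1,2\}^{\mathbb Z}\to\{1,2\}^{\mathbb Z}$, $\sigma((i_k)_k)=(i_{k+1})_k$, with the product topology on $\{1,2\}^{\mathbb Z}$. Semiconjugate via $h$ means $h\circ\psi=\sigma\circ h$ on $\Lambda$, with $h$ continuous and onto. *)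

theory Defs
  imports "HOL-Analysis.Analysis" "HOL-Library.Real_Mod"
begin

definition strictly_convex_on :: "real set \<Rightarrow> (real \<Rightarrow> real) \<Rightarrow> bool" where
  "strictly_convex_on S f \<longleftrightarrow> convex S \<and>
    (\<forall>x\<in>S. \<forall>y\<in>S. \<forall>u. x \<noteq> y \<and> 0 < u \<and> u < 1 \<longrightarrow>
       f ((1 - u) * x + u * y) < (1 - u) * f x + u * f y)"

definition strictly_concave_on :: "real set \<Rightarrow> (real \<Rightarrow> real) \<Rightarrow> bool" where
  "strictly_concave_on S f \<longleftrightarrow> strictly_convex_on S (\<lambda>x. - f x)"

(* For F continuous and 0 < a \<le> 1 the supremum is a maximum. *)
definition m_star :: "real \<Rightarrow> (real \<Rightarrow> real) \<Rightarrow> real \<Rightarrow> real" where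
  "m_star g F a = g / (SUP s\<in>{a..1}. F s / s)"

definition stepwise_weight :: "real \<Rightarrow> real \<Rightarrow> real \<Rightarrow> real \<Rightarrow> real \<Rightarrow> real" where
  "stepwise_weight \<alpha> \<beta> n0 n1 t = (if t rmod \<beta> < \<alpha> then n1 else n0)"

definition planar_field ::
    "real \<Rightarrow> (real \<Rightarrow> real) \<Rightarrow> (real \<Rightarrow> real) \<Rightarrow> real \<Rightarrow> real \<times> real \<Rightarrow> real \<times> real" where
  "planar_field g n F t = (\<lambda>(v, y). (y, g * v - n t * F v))"

(* Solution of the initial value problem z' = X(t,z), z(0) = z0 on [0,T] in the sense of
   Caratheodory: as the field is allowed to jump in t, the equation is required in integral form. *)
definition solves_ivp_on ::
    "(real \<Rightarrow> 'a \<Rightarrow> 'a) \<Rightarrow> real \<Rightarrow> 'a::euclidean_space \<Rightarrow> (real \<Rightarrow> 'a) \<Rightarrow> bool" where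
  "solves_ivp_on X T z0 \<zeta> \<longleftrightarrow>
     continuous_on {0..T} \<zeta> \<and> \<zeta> 0 = z0 \<and>
     (\<forall>t\<in>{0..T}. ((\<lambda>s. X s (\<zeta> s)) has_integral (\<zeta> t - z0)) {0..t})"

definition poincare_dom :: "(real \<Rightarrow> 'a \<Rightarrow> 'a) \<Rightarrow> real \<Rightarrow> 'a::euclidean_space set" where
  "poincare_dom X T = {z. \<exists>\<zeta>. solves_ivp_on X T z \<zeta>}"

(* Meaningful only on poincare_dom X T and if initial value problems have at most one solution. *)
definition poincare_map :: "(real \<Rightarrow> 'a \<Rightarrow> 'a) \<Rightarrow> real \<Rightarrow> 'a::euclidean_space \<Rightarrow> 'a" where
  "poincare_map X T z = (THE w. \<exists>\<zeta>. solves_ivp_on X T z \<zeta> \<and> \<zeta> T = w)"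

(* The type int => nat carries the product of the discrete topologies, and this set
   inherits from it the product topology of {1,2}^Z. *)
definition two_symbol_seqs :: "(int \<Rightarrow> nat) set" where
  "two_symbol_seqs = UNIV \<rightarrow> {1, 2}"

definition bernoulli_shift :: "(int \<Rightarrow> 'b) \<Rightarrow> int \<Rightarrow> 'b" where
  "bernoulli_shift i = (\<lambda>k. i (k + 1))"

definition periodic_seq :: "(int \<Rightarrow> 'b) \<Rightarrow> bool" where
  "periodic_seq i \<longleftrightarrow> (\<exists>p>0. \<forall>k. i (k + p) = i k)"

definition periodic_point :: "('a \<Rightarrow> 'a) \<Rightarrow> 'a \<Rightarrow> bool" where
  "periodic_point f z \<longleftrightarrow> (\<exists>p>0. (f ^^ p) z = z)"

definition semiconjugate_via ::
    "'a::topological_space set \<Rightarrow> ('a \<Rightarrow> 'a) \<Rightarrow> ('a \<Rightarrow> 'b) \<Rightarrow> 'b::topological_space set \<Rightarrow> ('b \<Rightarrow> 'b) \<Rightarrow> bool"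
  where
  "semiconjugate_via \<Lambda> f h \<Sigma> \<sigma> \<longleftrightarrow>
     continuous_on \<Lambda> h \<and> h ` \<Lambda> = \<Sigma> \<and> (\<forall>z\<in>\<Lambda>. h (f z) = \<sigma> (h z))"

end

theory Submission
  imports Defs
begin

text \<open>
  With the large weight \<open>n\<^sub>1\<close> the orbits inside the homoclinic loop of the origin turn around the
  point \<open>(a, 0)\<close> at angular speed of order \<open>sqrt n\<^sub>1\<close> on an inner energy level, while on the loop itself
  they never complete a turn. So a path in a rectangle \<open>R\<close> from the inner level to the loop is wound
  several times around \<open>(a, 0)\<close>. With the small weight \<open>n\<^sub>0\<close> the force is nonnegative for \<open>v \<ge> 0\<close> and
  pushes each passage of this spiral through the quadrant \<open>v \<le> a\<close>, \<open>y \<ge> 0\<close> across \<open>R\<close>.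

  The chaotic part avoids paths: on the points that make \<open>i\<close> turns the first coordinate of the return
  map extends continuously to all of \<open>R\<close> with values left of \<open>R\<close> on one vertical side and right of
  \<open>R\<close> on the other. Such maps are closed under composition after clamping, and Brouwer's theorem gives
  each of them a fixed point in \<open>R\<close>; this yields a periodic orbit for every periodic itinerary.
  The other itineraries follow by compactness of the space of full orbits.
\<close>

section \<open>Maps that stretch a rectangle across itself\<close>

text \<open>The threshold for \<open>n1\<close> has to be fixed before \<open>n0\<close> is known.
  Therefore the weak flow enters only through 0 <= force <= \<open>k\<close> * v on [0,1], with
  \<open>k\<close> built from \<open>m_star\<close> and not from \<open>n0\<close>; the sides of the
  rectangle, the inner level and every largeness condition on the strong weight are expressed
  through \<open>k\<close>. The symbol i of a point is read from its angle at the switching time: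
  the window from pi/2 - 2 pi i to pi - 2 pi i is the second quadrant after i clockwise turns. The
  loop keeps the angle above -pi, the upper end of the window of i = 1, and the inner level takes it
  below -7 pi/2, the lower end of the window of i = 2, so both windows lie strictly in between. The
  extension of the return map is continuous because the weak push has a definite outcome at both
  ends of a window: at one end the point is at rest so near the origin that it cannot pass v = a, at
  the other it crosses v = a so fast that it gets beyond v = 1. Landing between the vertical sides
  already forces the right height, since position and speed both increase during the push; no
  separate control of the second coordinate is needed.\<close>

definition clamp_fst :: "real \<Rightarrow> real \<Rightarrow> real \<times> real \<Rightarrow> real \<times> real" where
  "clamp_fst c d = (\<lambda>(x, y). (max c (min d x), y))"

definition crossing :: "real \<Rightarrow> real \<Rightarrow> real \<Rightarrow> real \<Rightarrow> (real \<times> real \<Rightarrow> real \<times> real) \<Rightarrow> bool" where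
  "crossing c d p q M \<longleftrightarrow>
     continuous_on ({c..d} \<times> {p..q}) M \<and> (\<forall>z\<in>{c..d} \<times> {p..q}. snd (M z) \<in> {p..q}) \<and>
     ((\<forall>y\<in>{p..q}. fst (M (c, y)) < c \<and> d < fst (M (d, y))) \<or>
      (\<forall>y\<in>{p..q}. d < fst (M (c, y)) \<and> fst (M (d, y)) < c))"

text \<open>Brouwer needs a self-map, so the first coordinate is clamped to \<open>{c..d}\<close>.
  Clamping can create spurious fixed points only on the two vertical sides, hence the clamped map
  must move these sides inward.\<close>

lemma crossing_fixed_point:
  assumes "crossing c d p q M" "c \<le> d" "p \<le> q"
  obtains z where "z \<in> {c..d} \<times> {p..q}" "M z = z"
proof -
  let ?R = "{c..d} \<times> {p..q}"
  have R: "compact ?R" "convex ?R" "?R \<noteq> {}"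
    using assms by (auto intro: compact_Times convex_Times)
  have cM: "continuous_on ?R M" and sM: "\<And>z. z \<in> ?R \<Longrightarrow> snd (M z) \<in> {p..q}"
    using assms(1) by (auto simp: crossing_def)
  define dir where "dir = (\<forall>y\<in>{p..q}. fst (M (c, y)) < c \<and> d < fst (M (d, y)))"
  \<comment> \<open>In the order preserving case the clamp of \<open>M\<close> would fix the sides.
    Reversing the horizontal displacement, x - (M1 - x), keeps the true fixed points and turns the
    sides inward.\<close>
  define N where "N z = clamp_fst c d (if dir then 2 * fst z - fst (M z) else fst (M z), snd (M z))" for z
  have "continuous_on ?R N"
    unfolding N_def clamp_fst_def case_prod_beta using cM by (cases dir) (auto intro!: continuous_intros)
  moreover have "N ` ?R \<subseteq> ?R"
    using sM assms(2) by (fastforce simp: N_def clamp_fst_def)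
  ultimately obtain z where z: "z \<in> ?R" "N z = z"
    using brouwer[OF R(1,2,3)] by blast
  obtain x y where xy: "z = (x, y)" "y \<in> {p..q}" using z(1) by (cases z) auto
  have Nz: "max c (min d (if dir then 2 * x - fst (M z) else fst (M z))) = x" "snd (M z) = y"
    using z(2) by (auto simp: N_def clamp_fst_def xy(1))
  have "fst (M z) = x"
  proof (cases dir)
    case True
    then have "max c (min d (2 * x - fst (M z))) = x" using Nz(1) by simp
    moreover have "x = c \<Longrightarrow> fst (M z) < c" "x = d \<Longrightarrow> d < fst (M z)"
      using True xy unfolding dir_def by auto
    ultimately show ?thesis using assms(2) by (auto simp: max_def min_def split: if_splits)
  next
    case False
    then have "max c (min d (fst (M z))) = x" using Nz(1) by simp
    moreover have "\<forall>y\<in>{p..q}. d < fst (M (c, y)) \<and> fst (M (d, y)) < c"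
      using False assms(1) by (auto simp: crossing_def dir_def)
    then have "x = c \<Longrightarrow> d < fst (M z)" "x = d \<Longrightarrow> fst (M z) < c"
      using xy by auto
    ultimately show ?thesis using assms(2) by (auto simp: max_def min_def split: if_splits)
  qed
  then show ?thesis using that[OF z(1)] Nz(2) xy(1) by (metis prod.collapse)
qed

text \<open>A vertical side is thrown beyond the strip by \<open>M\<close>, and the clamp puts it
  back on one of the two sides, where the behaviour of \<open>M'\<close> is prescribed. The four
  combinations of orientations all give a crossing.\<close>

lemma crossing_comp:
  assumes "crossing c d p q M" "crossing c d p q M'" "c \<le> d"
  shows "crossing c d p q (\<lambda>z. M' (clamp_fst c d (M z)))"
proof -
  let ?R = "{c..d} \<times> {p..q}"
  have cM: "continuous_on ?R M" "continuous_on ?R M'"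
    and sM: "\<And>z. z \<in> ?R \<Longrightarrow> snd (M z) \<in> {p..q}" "\<And>z. z \<in> ?R \<Longrightarrow> snd (M' z) \<in> {p..q}"
    using assms by (auto simp: crossing_def)
  have cl: "clamp_fst c d (M z) \<in> ?R" if "z \<in> ?R" for z
    using sM(1)[OF that] assms(3) by (auto simp: clamp_fst_def split: prod.splits)
  have "continuous_on ?R (\<lambda>z. clamp_fst c d (M z))"
    unfolding clamp_fst_def case_prod_beta using cM by (auto intro!: continuous_intros)
  then have 1: "continuous_on ?R (\<lambda>z. M' (clamp_fst c d (M z)))"
    by (rule continuous_on_compose2[OF cM(2)]) (use cl in blast)
  have lo: "clamp_fst c d (M z) = (c, snd (M z))" if "fst (M z) < c" for z
    using that assms(3) by (auto simp: clamp_fst_def split: prod.splits)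
  have hi: "clamp_fst c d (M z) = (d, snd (M z))" if "fst (M z) > d" for z
    using that assms(3) by (auto simp: clamp_fst_def split: prod.splits)
  have s: "snd (M (c, y)) \<in> {p..q}" "snd (M (d, y)) \<in> {p..q}" if "y \<in> {p..q}" for y
    using that sM(1) assms(3) by auto
  have 2: "(\<forall>y\<in>{p..q}. fst (M (c, y)) < c \<and> d < fst (M (d, y))) \<or>
      (\<forall>y\<in>{p..q}. d < fst (M (c, y)) \<and> fst (M (d, y)) < c)"
    "(\<forall>y\<in>{p..q}. fst (M' (c, y)) < c \<and> d < fst (M' (d, y))) \<or>
      (\<forall>y\<in>{p..q}. d < fst (M' (c, y)) \<and> fst (M' (d, y)) < c)"
    using assms unfolding crossing_def by blast+
  have 3: "(\<forall>y\<in>{p..q}. fst (M' (clamp_fst c d (M (c, y)))) < c \<and> d < fst (M' (clamp_fst c d (M (d, y))))) \<or>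
      (\<forall>y\<in>{p..q}. d < fst (M' (clamp_fst c d (M (c, y)))) \<and> fst (M' (clamp_fst c d (M (d, y)))) < c)"
    using 2
    by (elim disjE) (use s lo hi in auto)
  show ?thesis unfolding crossing_def using 1 3 cl sM(2) by blast
qed

text \<open>The clamp cannot hide an escape: a point that it moves ends up on a vertical side, and
  \<open>M'\<close> sends both sides out of the strip. A composite that ends in the rectangle is
  thus a genuine composite.\<close>

lemma crossing_comp_in:
  assumes "crossing c d p q M" "crossing c d p q M'" "c \<le> d"
    and "z \<in> {c..d} \<times> {p..q}" "M' (clamp_fst c d (M z)) \<in> {c..d} \<times> {p..q}"
  shows "M z \<in> {c..d} \<times> {p..q}" "clamp_fst c d (M z) = M z"
proof -
  have s: "snd (M z) \<in> {p..q}" using assms by (auto simp: crossing_def)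
  have "\<not> fst (M z) < c"
  proof
    assume "fst (M z) < c"
    then have "clamp_fst c d (M z) = (c, snd (M z))"
      using assms(3) by (auto simp: clamp_fst_def split: prod.splits)
    then show False using assms(2,3,5) s unfolding crossing_def by fastforce
  qed
  moreover have "\<not> fst (M z) > d"
  proof
    assume "fst (M z) > d"
    then have "clamp_fst c d (M z) = (d, snd (M z))"
      using assms(3) by (auto simp: clamp_fst_def split: prod.splits)
    then show False using assms(2,3,5) s unfolding crossing_def by fastforce
  qed
  ultimately show "M z \<in> {c..d} \<times> {p..q}" using s by (cases "M z") auto
  then show "clamp_fst c d (M z) = M z" by (auto simp: clamp_fst_def split: prod.splits)
qed

text \<open>A fixed point of the clamped composite of \<open>M 0\<close>, ..., \<open>M n\<close> is
  unwound from its end by \<open>crossing_comp_in\<close>, which shows that none of the clamps has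
  acted.\<close>

lemma crossing_cycle:
  fixes M :: "nat \<Rightarrow> real \<times> real \<Rightarrow> real \<times> real"
  assumes "\<And>j. crossing c d p q (M j)" "c \<le> d" "p \<le> q"
  obtains w where "\<And>j. j \<le> Suc n \<Longrightarrow> w j \<in> {c..d} \<times> {p..q}"
    "\<And>j. j \<le> n \<Longrightarrow> w (Suc j) = M j (w j)" "w (Suc n) = w 0"
proof -
  let ?R = "{c..d} \<times> {p..q}"
  define C where "C = rec_nat (M 0) (\<lambda>j C z. M (Suc j) (clamp_fst c d (C z)))"
  have C0: "C 0 = M 0" and CS: "\<And>j. C (Suc j) = (\<lambda>z. M (Suc j) (clamp_fst c d (C j z)))"
    by (simp_all add: C_def)
  have cr: "crossing c d p q (C j)" for j
    by (induction j) (simp_all add: C0 CS assms crossing_comp)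
  obtain z where z: "z \<in> ?R" "C n z = z" using crossing_fixed_point[OF cr assms(2,3)] by blast
  have orbit: "C j z \<in> ?R \<and> (\<forall>i<j. C (Suc i) z = M (Suc i) (C i z) \<and> C i z \<in> ?R)" if "C j z \<in> ?R" for j
    using that
  proof (induction j)
    case (Suc j)
    then have "M (Suc j) (clamp_fst c d (C j z)) \<in> ?R" by (simp add: CS)
    from crossing_comp_in[OF cr assms(1) assms(2) z(1) this]
    have "C j z \<in> ?R" "C (Suc j) z = M (Suc j) (C j z)" by (simp_all add: CS)
    then show ?case using Suc by (auto simp: less_Suc_eq)
  qed auto
  have b: "\<And>i. i < n \<Longrightarrow> C (Suc i) z = M (Suc i) (C i z) \<and> C i z \<in> ?R"
    using orbit[of n] z by auto
  \<comment> \<open>The index shifts by one: \<open>C i\<close> has already applied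
    \<open>M 0\<close> up to \<open>M i\<close>, so it gives position i + 1 of the cycle.\<close>
  define w where "w j = (case j of 0 \<Rightarrow> z | Suc i \<Rightarrow> C i z)" for j
  show ?thesis
  proof (rule that[of w])
    show "w j \<in> ?R" if "j \<le> Suc n" for j
      using that b z by (cases j) (auto simp: w_def le_less simp del: mem_Sigma_iff)
    show "w (Suc j) = M j (w j)" if "j \<le> n" for j
      using that b by (cases j) (auto simp: w_def C0)
    show "w (Suc n) = w 0" using z by (simp add: w_def)
  qed
qed

text \<open>The \<open>M i\<close> agree with \<open>\<psi>\<close> wherever they stay in the
  rectangle, so each cycle of them is a periodic orbit of \<open>\<psi>\<close> with prescribed
  symbols. The full orbits inside \<open>H 1 \<union> H 2\<close> form a compact space, being cut
  out of a Tychonoff product by closed conditions, and \<Lambda> consists of their points at time 0.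
  Hence the image of \<open>h\<close> is compact and, containing the periodic sequences, is
  everything.\<close>

theorem crossing_horseshoe:
  fixes \<psi> :: "real \<times> real \<Rightarrow> real \<times> real" and H :: "nat \<Rightarrow> (real \<times> real) set"
  assumes cd: "c \<le> d" "p \<le> q"
    and H: "\<And>i. i \<in> {1,2} \<Longrightarrow> compact (H i)" "H 1 \<inter> H 2 = {}"
    and \<psi>: "continuous_on (H 1 \<union> H 2) \<psi>" "inj_on \<psi> (H 1 \<union> H 2)"
    and M: "\<And>i. i \<in> {1,2} \<Longrightarrow> crossing c d p q (M i)"
      "\<And>i z. i \<in> {1,2} \<Longrightarrow> z \<in> {c..d} \<times> {p..q} \<Longrightarrow> M i z \<in> {c..d} \<times> {p..q} \<Longrightarrow> z \<in> H i \<and> M i z = \<psi> z"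
  obtains \<Lambda> h where "compact \<Lambda>" "\<Lambda> \<subseteq> H 1 \<union> H 2" "\<psi> ` \<Lambda> = \<Lambda>"
    "semiconjugate_via \<Lambda> \<psi> h two_symbol_seqs bernoulli_shift"
    "\<And>s. s \<in> two_symbol_seqs \<Longrightarrow> periodic_seq s \<Longrightarrow> \<exists>z\<in>\<Lambda>. periodic_point \<psi> z \<and> h z = s"
proof -
  let ?H = "H 1 \<union> H 2"
  define orbits where "orbits = {\<zeta> :: int \<Rightarrow> real \<times> real. \<forall>k. \<zeta> k \<in> ?H \<and> \<zeta> (k + 1) = \<psi> (\<zeta> k)}"
  define \<Lambda> where "\<Lambda> = (\<lambda>\<zeta>. \<zeta> 0) ` orbits"
  define sym where "sym z = (if z \<in> H 1 then 1 else 2 :: nat)" for z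
  \<comment> \<open>Since \<open>\<psi>\<close> is injective, a full orbit is determined by its
    point at time 0. By compactness of \<open>orbits\<close> this recovery is continuous.\<close>
  define lift where "lift = inv_into orbits (\<lambda>\<zeta>. \<zeta> 0)"
  define h where "h z = (\<lambda>k. sym (lift z k))" for z
  have cH: "compact ?H" "closed (H 1)" "closed (H 2)" using H(1) by (auto intro: compact_imp_closed)
  have coord: "continuous_on S (\<lambda>\<zeta>. \<zeta> k)" for S :: "(int \<Rightarrow> real \<times> real) set" and k
    by (rule continuous_on_subset[OF continuous_on_product_coordinates]) simp
  have inj: "inj_on (\<lambda>\<zeta>. \<zeta> 0) orbits"
  proof (rule inj_onI)
    fix \<zeta> \<eta> assume A: "\<zeta> \<in> orbits" "\<eta> \<in> orbits" "\<zeta> 0 = \<eta> 0"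
    show "\<zeta> = \<eta>"
    proof
      fix k show "\<zeta> k = \<eta> k"
      proof (induction k rule: int_induct[where k = 0])
        case (step1 i)
        then show ?case using A(1,2) by (simp add: orbits_def)
      next
        case (step2 i)
        have "\<psi> (\<zeta> (i - 1)) = \<psi> (\<eta> (i - 1))"
          using A(1,2) step2 unfolding orbits_def by (metis (mono_tags, lifting) diff_add_cancel mem_Collect_eq)
        then show ?case using A(1,2) \<psi>(2) unfolding orbits_def inj_on_def by blast
      qed (use A in auto)
    qed
  qed
  have "compact (PiE UNIV (\<lambda>_. ?H) :: (int \<Rightarrow> real \<times> real) set)"
    using cH(1) unfolding compactin_euclidean_iff[symmetric] euclidean_product_topology[symmetric]
    by (subst compactin_PiE) auto
  then have cP: "compact {\<zeta> :: int \<Rightarrow> real \<times> real. \<forall>k. \<zeta> k \<in> ?H}" (is "compact ?P")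
    by (simp add: PiE_UNIV_domain Pi_def)
  have "closed {\<zeta> \<in> ?P. \<zeta> (k + 1) - \<psi> (\<zeta> k) = 0}" for k
  proof -
    have "continuous_on ?P (\<lambda>\<zeta>. \<zeta> (k + 1) - \<psi> (\<zeta> k))"
      by (intro continuous_intros coord continuous_on_compose2[OF \<psi>(1) coord]) auto
    from continuous_closed_preimage_constant[OF this compact_imp_closed[OF cP]] show ?thesis .
  qed
  then have "closed (\<Inter>k. {\<zeta> \<in> ?P. \<zeta> (k + 1) - \<psi> (\<zeta> k) = 0})" by blast
  moreover have "orbits = ?P \<inter> (\<Inter>k. {\<zeta> \<in> ?P. \<zeta> (k + 1) - \<psi> (\<zeta> k) = 0})"
    by (auto simp: orbits_def)
  ultimately have cO: "compact orbits" using cP by (simp add: compact_Int_closed)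
  have c\<Lambda>: "compact \<Lambda>" unfolding \<Lambda>_def by (rule compact_continuous_image[OF coord cO])
  have lift: "lift (\<zeta> 0) = \<zeta>" if "\<zeta> \<in> orbits" for \<zeta>
    using that inj unfolding lift_def by (metis inv_into_f_f)
  have clift: "continuous_on \<Lambda> lift"
    unfolding \<Lambda>_def by (rule continuous_on_inv[OF coord cO]) (use lift in auto)
  have lift_in: "lift z \<in> orbits" "lift z 0 = z" if "z \<in> \<Lambda>" for z
    using that lift by (auto simp: \<Lambda>_def)
  have shift: "(\<lambda>k. \<zeta> (k + m)) \<in> orbits" if "\<zeta> \<in> orbits" for \<zeta> m
  proof -
    have "\<zeta> (k + 1 + m) = \<psi> (\<zeta> (k + m))" for k
    proof -
      have "k + 1 + m = (k + m) + 1" by simp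
      then show ?thesis using that by (simp only: orbits_def mem_Collect_eq)
    qed
    then show ?thesis using that by (simp add: orbits_def)
  qed
  \<comment> \<open>The two sets are closed and disjoint, so the symbol is locally constant on their
    union.\<close>
  have csym: "continuous_on ?H sym"
  proof -
    have "continuous_on (H 1 \<union> H 2) (\<lambda>z. if z \<in> H 1 then 1 else 2 :: nat)"
      by (rule continuous_on_cases) (use cH H(2) in auto)
    then show ?thesis by (simp add: sym_def)
  qed
  have ch: "continuous_on \<Lambda> h"
  proof (rule continuous_on_coordinatewise_then_product)
    fix k
    have "continuous_on \<Lambda> (\<lambda>z. lift z k)" by (rule continuous_on_product_then_coordinatewise[OF clift])
    then have "continuous_on \<Lambda> (\<lambda>z. sym (lift z k))"
      by (rule continuous_on_compose2[OF csym]) (use lift_in(1) in \<open>simp add: orbits_def image_subset_iff\<close>)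
    then show "continuous_on \<Lambda> (\<lambda>z. h z k)" by (simp add: h_def)
  qed
  have periodic: "\<exists>z\<in>\<Lambda>. periodic_point \<psi> z \<and> h z = s"
    if s: "s \<in> two_symbol_seqs" "periodic_seq s" for s
  proof -
    obtain P where P: "P > 0" "\<And>k. s (k + P) = s k" using s(2) by (auto simp: periodic_seq_def)
    have s12: "s k \<in> {1,2}" for k using s(1) by (auto simp: two_symbol_seqs_def)
    have sP: "s (k + m * P) = s k" for k m
    proof (induction m rule: int_induct[where k = 0])
      case (step1 i) then show ?case using P(2)[of "k + i * P"] by (simp add: algebra_simps)
    next
      case (step2 i) then show ?case using P(2)[of "k + (i - 1) * P"] by (simp add: algebra_simps)
    qed auto
    have smod: "s (k mod P) = s k" for k
      using sP[of "k mod P" "k div P"] by simp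
    define n where "n = nat P - 1"
    have n: "int (Suc n) = P" using P(1) by (simp add: n_def)
    obtain w where w: "\<And>j. j \<le> Suc n \<Longrightarrow> w j \<in> {c..d} \<times> {p..q}"
      "\<And>j. j \<le> n \<Longrightarrow> w (Suc j) = M (s (int j)) (w j)" "w (Suc n) = w 0"
      using crossing_cycle[of c d p q "\<lambda>j. M (s (int j))" n] M(1)[OF s12] cd by auto
    have wH: "w j \<in> H (s (int j))" "w (Suc j) = \<psi> (w j)" if "j \<le> n" for j
      using M(2)[OF s12, of "w j" "int j"] w(1)[of j] w(1)[of "Suc j"] w(2)[of j] that by auto
    \<comment> \<open>The cycle has length \<open>P\<close>, that is \<open>n + 1\<close>, and is
      continued to all integers by reduction mod \<open>P\<close>. At the residue
      \<open>P - 1\<close> the orbit equation is the closing condition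
      \<open>w (Suc n) = w 0\<close>.\<close>
    define \<zeta> where "\<zeta> k = w (nat (k mod P))" for k
    have le: "nat (k mod P) \<le> n" "int (nat (k mod P)) = k mod P" for k
      using n P(1) pos_mod_bound[of P k] pos_mod_sign[of P k] by linarith+
    have \<zeta>H: "\<zeta> k \<in> H (s k)" for k
      using wH(1)[OF le(1)[of k]] unfolding \<zeta>_def le(2) smod .
    have "\<zeta> (k + 1) = \<psi> (\<zeta> k)" for k
    proof -
      have *: "\<psi> (\<zeta> k) = w (Suc (nat (k mod P)))"
        unfolding \<zeta>_def by (rule wH(2)[OF le(1), symmetric])
      have **: "(k + 1) mod P = (k mod P + 1) mod P" by (simp add: mod_add_left_eq)
      show ?thesis
      proof (cases "k mod P = P - 1")
        case True
        then have "(k + 1) mod P = 0" using ** by simp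
        moreover have "nat (k mod P) = n" using True n by linarith
        ultimately show ?thesis using * w(3) by (simp add: \<zeta>_def)
      next
        case False
        then have "(k + 1) mod P = k mod P + 1"
          using P(1) pos_mod_bound[of P k] pos_mod_sign[of P k]
          unfolding ** by (intro mod_pos_pos_trivial) linarith+
        moreover have "nat (k mod P + 1) = Suc (nat (k mod P))" using P(1) pos_mod_sign[of P k] by linarith
        ultimately show ?thesis using * by (simp add: \<zeta>_def)
      qed
    qed
    moreover have "H (s k) \<subseteq> ?H" for k using s12[of k] by auto
    ultimately have \<zeta>: "\<zeta> \<in> orbits" using \<zeta>H by (auto simp: orbits_def)
    have "(\<psi> ^^ m) (\<zeta> 0) = \<zeta> (int m)" for m
    proof (induction m)
      case (Suc m)
      have "\<zeta> (int m + 1) = \<psi> (\<zeta> (int m))" using \<zeta> unfolding orbits_def by blast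
      then show ?case using Suc by (simp add: add.commute)
    qed simp
    from this[of "Suc n"] have "(\<psi> ^^ Suc n) (\<zeta> 0) = \<zeta> 0"
      unfolding n by (simp add: \<zeta>_def)
    then have "periodic_point \<psi> (\<zeta> 0)" unfolding periodic_point_def by blast
    moreover have "sym (\<zeta> k) = s k" for k
      using \<zeta>H[of k] s12[of k] H(2) by (auto simp: sym_def)
    then have "h (\<zeta> 0) = s" by (auto simp: h_def lift[OF \<zeta>])
    ultimately show ?thesis using \<zeta> by (auto simp: \<Lambda>_def)
  qed
  have h_into: "h ` \<Lambda> \<subseteq> two_symbol_seqs"
    by (auto simp: h_def two_symbol_seqs_def sym_def)
  have "two_symbol_seqs \<subseteq> h ` \<Lambda>"
  proof
    fix s assume s: "s \<in> two_symbol_seqs"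
    \<comment> \<open>The block of \<open>s\<close> on [-m, m] is repeated with period 2m + 1. So
      \<open>r m\<close> is periodic and agrees with \<open>s\<close> on a window that exhausts the
      integers.\<close>
    define r where "r m k = s ((k + int m) mod (2 * int m + 1) - int m)" for m k
    have "r m \<in> h ` \<Lambda>" for m
    proof -
      have "r m \<in> two_symbol_seqs" using s by (auto simp: two_symbol_seqs_def r_def)
      moreover have "periodic_seq (r m)"
        unfolding periodic_seq_def
      proof (intro exI conjI allI)
        fix k
        have "(k + (2 * int m + 1) + int m) mod (2 * int m + 1) = (k + int m) mod (2 * int m + 1)"
          using mod_add_self2[of "k + int m" "2 * int m + 1"] by (simp add: add_ac)
        then show "r m (k + (2 * int m + 1)) = r m k" by (simp only: r_def)
      qed simp
      ultimately show ?thesis using periodic by (metis image_eqI)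
    qed
    then have r\<Lambda>: "e (r m) \<in> (\<lambda>z. e (h z)) ` \<Lambda>" for m and e :: "(int \<Rightarrow> nat) \<Rightarrow> int \<Rightarrow> real"
      by (metis (no_types, lifting) imageE imageI)
    \<comment> \<open>The limit is taken among real sequences; the embedding is injective, so
      membership in the image is carried back to \<open>s\<close>.\<close>
    define emb :: "(int \<Rightarrow> nat) \<Rightarrow> int \<Rightarrow> real" where "emb = (\<lambda>s k. real (s k))"
    have lim: "(\<lambda>m. emb (r m)) \<longlonglongrightarrow> emb s"
    proof -
      have "((\<lambda>m. emb (r m) k) \<longlongrightarrow> emb s k) sequentially" for k
      proof (rule tendsto_eventually, unfold eventually_sequentially, intro exI allI impI)
        fix m assume "nat \<bar>k\<bar> \<le> m"
        then have "(k + int m) mod (2 * int m + 1) = k + int m"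
          by (intro mod_pos_pos_trivial) linarith+
        then show "emb (r m) k = emb s k" by (simp add: r_def emb_def)
      qed
      then have "limitin (product_topology (\<lambda>_. euclidean) UNIV) (\<lambda>m. emb (r m)) (emb s) sequentially"
        by (simp add: limitin_componentwise)
      then show ?thesis by (simp add: euclidean_product_topology)
    qed
    have "continuous_on \<Lambda> (\<lambda>z. emb (h z))"
      unfolding emb_def
      by (intro continuous_on_coordinatewise_then_product continuous_on_of_nat
          continuous_on_product_then_coordinatewise[OF ch])
    then have cl: "closed ((\<lambda>z. emb (h z)) ` \<Lambda>)"
      using compact_continuous_image[OF _ c\<Lambda>] compact_imp_closed by blast
    have "emb s \<in> (\<lambda>z. emb (h z)) ` \<Lambda>" by (rule closed_sequentially[OF cl r\<Lambda> lim])
    moreover have "inj emb" by (auto simp: inj_def emb_def fun_eq_iff)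
    ultimately show "s \<in> h ` \<Lambda>" by (auto simp: inj_eq)
  qed
  moreover have \<psi>\<Lambda>: "\<psi> z \<in> \<Lambda>" "h (\<psi> z) = bernoulli_shift (h z)" if "z \<in> \<Lambda>" for z
  proof -
    have "\<psi> z = lift z (0 + 1)" using lift_in[OF that] by (auto simp: orbits_def simp del: add_0)
    moreover have s: "(\<lambda>k. lift z (k + 1)) \<in> orbits" by (rule shift[OF lift_in(1)[OF that]])
    ultimately show "h (\<psi> z) = bernoulli_shift (h z)"
      using lift[OF s] by (simp add: h_def bernoulli_shift_def)
    show "\<psi> z \<in> \<Lambda>"
      unfolding \<Lambda>_def by (rule image_eqI[OF _ s]) (simp add: \<open>\<psi> z = lift z (0 + 1)\<close>)
  qed
  moreover have "z \<in> \<psi> ` \<Lambda>" if "z \<in> \<Lambda>" for z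
  proof
    let ?z = "lift z (0 - 1)"
    have "lift z (-1 + 1) = \<psi> (lift z (-1))"
      using lift_in(1)[OF that] unfolding orbits_def by blast
    then show "z = \<psi> ?z" using lift_in(2)[OF that] by simp
    have "(\<lambda>k. lift z (k + -1)) \<in> orbits" by (rule shift[OF lift_in(1)[OF that]])
    then show "?z \<in> \<Lambda>" unfolding \<Lambda>_def by (rule image_eqI[rotated]) simp
  qed
  ultimately have "\<psi> ` \<Lambda> = \<Lambda>" "semiconjugate_via \<Lambda> \<psi> h two_symbol_seqs bernoulli_shift"
    using ch h_into by (auto simp: semiconjugate_via_def)
  moreover have "\<Lambda> \<subseteq> ?H" by (auto simp: \<Lambda>_def orbits_def)
  ultimately show thesis using that c\<Lambda> periodic by blast
qed

section \<open>Autonomous differential equations\<close>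

text \<open>One-sided derivatives at the ends allow two pieces with different fields to meet at the
  switching time.\<close>

definition autonomous_solution ::
    "('a \<Rightarrow> 'a) \<Rightarrow> real \<Rightarrow> real \<Rightarrow> (real \<Rightarrow> 'a::real_normed_vector) \<Rightarrow> bool" where
  "autonomous_solution X s T x \<longleftrightarrow>
     (\<forall>t\<in>{s..T}. (x has_vector_derivative X (x t)) (at t within {s..T}))"

lemma autonomous_solution_continuous:
  "autonomous_solution X s T x \<Longrightarrow> continuous_on {s..T} x"
  unfolding autonomous_solution_def
  by (auto simp: continuous_on_eq_continuous_within intro: has_vector_derivative_continuous)

lemma autonomous_solution_at:
  assumes "autonomous_solution X s T x" "s < t" "t < T"
  shows "(x has_vector_derivative X (x t)) (at t)"
proof -
  have "(x has_vector_derivative X (x t)) (at t within {s..T})"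
    using assms unfolding autonomous_solution_def by auto
  then show ?thesis using assms(2,3) by (simp add: at_within_Icc_at)
qed

lemma autonomous_solution_subset:
  "autonomous_solution X s T x \<Longrightarrow> s \<le> s' \<Longrightarrow> T' \<le> T \<Longrightarrow> autonomous_solution X s' T' x"
  unfolding autonomous_solution_def
  by (meson atLeastatMost_subset_iff has_vector_derivative_within_subset in_mono)

lemma autonomous_solution_cong:
  assumes "\<And>t. t \<in> {s..T} \<Longrightarrow> X (x t) = Y (x t)"
  shows "autonomous_solution X s T x \<longleftrightarrow> autonomous_solution Y s T x"
  unfolding autonomous_solution_def using assms by auto

text \<open>The squared distance u satisfies |u'| <= 2 K u, so u times exp(-2 K t) decreases and u
  times exp(2 K t) increases. The second estimate later makes the flow injective. The Lipschitz
  bound is asked only along the two solutions, which serves globally and locally Lipschitz fields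
  alike.\<close>

lemma autonomous_solution_gronwall:
  fixes x y :: "real \<Rightarrow> 'a::real_inner"
  assumes x: "autonomous_solution X a b x" and y: "autonomous_solution X a b y"
    and lip: "\<And>t. t \<in> {a..b} \<Longrightarrow> norm (X (x t) - X (y t)) \<le> K * norm (x t - y t)"
    and t: "t \<in> {a..b}"
  shows "norm (x t - y t) \<le> exp (K * (t - a)) * norm (x a - y a)"
    and "norm (x a - y a) \<le> exp (K * (t - a)) * norm (x t - y t)"
proof -
  define u where "u t = (x t - y t) \<bullet> (x t - y t)" for t
  have u: "u t = (norm (x t - y t))\<^sup>2" for t by (simp add: u_def power2_norm_eq_inner)
  define u' where "u' t = 2 * ((x t - y t) \<bullet> (X (x t) - X (y t)))" for t
  have du: "(u has_real_derivative u' s) (at s)" if "s \<in> {a<..<b}" for s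
  proof -
    have "(x has_vector_derivative X (x s)) (at s)" "(y has_vector_derivative X (y s)) (at s)"
      using that x y by (auto intro: autonomous_solution_at)
    then have "((\<lambda>s. x s - y s) has_derivative (\<lambda>h. h *\<^sub>R (X (x s) - X (y s)))) (at s)"
      using has_vector_derivative_diff unfolding has_vector_derivative_def by blast
    from has_derivative_inner[OF this this] show ?thesis
      unfolding has_field_derivative_def u_def u'_def
      by (rule has_derivative_eq_rhs) (auto simp: inner_commute algebra_simps)
  qed
  have u'_le: "\<bar>u' s\<bar> \<le> 2 * K * u s" if "s \<in> {a..b}" for s
  proof -
    have "\<bar>u' s\<bar> \<le> 2 * (norm (x s - y s) * norm (X (x s) - X (y s)))"
      unfolding u'_def using Cauchy_Schwarz_ineq2[of "x s - y s" "X (x s) - X (y s)"] by (simp add: abs_mult)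
    also have "\<dots> \<le> 2 * (norm (x s - y s) * (K * norm (x s - y s)))"
      using lip[OF that] by (intro mult_left_mono) auto
    finally show ?thesis by (simp add: u power2_eq_square algebra_simps)
  qed
  have cu: "continuous_on {a..t} u"
    unfolding u_def using t
    by (intro continuous_intros continuous_on_subset[OF autonomous_solution_continuous[OF x]]
        continuous_on_subset[OF autonomous_solution_continuous[OF y]]) auto
  have "exp (- (2 * K) * (a - a)) * u a \<ge> exp (- (2 * K) * (t - a)) * u t"
  proof (rule DERIV_nonpos_imp_decreasing_open[where f = "\<lambda>s. exp (- (2 * K) * (s - a)) * u s"])
    fix s assume s: "a < s" "s < t"
    have "((\<lambda>s. exp (- (2 * K) * (s - a)) * u s) has_real_derivative
        exp (- (2 * K) * (s - a)) * (u' s - 2 * K * u s)) (at s)"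
      using s t by (auto intro!: derivative_eq_intros du simp: algebra_simps)
    moreover have "exp (- (2 * K) * (s - a)) * (u' s - 2 * K * u s) \<le> 0"
      using u'_le[of s] s t by (auto simp: mult_le_0_iff)
    ultimately show "\<exists>D. ((\<lambda>s. exp (- (2 * K) * (s - a)) * u s) has_real_derivative D) (at s) \<and> D \<le> 0"
      by blast
  qed (use t in \<open>auto intro!: continuous_intros cu\<close>)
  then have "exp (2 * K * (t - a)) * (exp (- (2 * K) * (t - a)) * u t) \<le> exp (2 * K * (t - a)) * u a"
    by (intro mult_left_mono) auto
  moreover have "exp (2 * K * (t - a)) * (exp (- (2 * K) * (t - a)) * u t) = u t"
    unfolding mult.assoc[symmetric] exp_add[symmetric] by simp
  moreover have sq: "(exp (K * (t - a)))\<^sup>2 = exp (2 * K * (t - a))"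
    unfolding power2_eq_square exp_add[symmetric] by simp
  ultimately have "u t \<le> (exp (K * (t - a)))\<^sup>2 * u a" by metis
  then have "(norm (x t - y t))\<^sup>2 \<le> (exp (K * (t - a)) * norm (x a - y a))\<^sup>2"
    by (simp add: u power_mult_distrib)
  then show "norm (x t - y t) \<le> exp (K * (t - a)) * norm (x a - y a)"
    by (rule power2_le_imp_le) simp
  have "exp (2 * K * (a - a)) * u a \<le> exp (2 * K * (t - a)) * u t"
  proof (rule DERIV_nonneg_imp_increasing_open[where f = "\<lambda>s. exp (2 * K * (s - a)) * u s"])
    fix s assume s: "a < s" "s < t"
    have "((\<lambda>s. exp (2 * K * (s - a)) * u s) has_real_derivative
        exp (2 * K * (s - a)) * (u' s + 2 * K * u s)) (at s)"
      using s t by (auto intro!: derivative_eq_intros du simp: algebra_simps)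
    moreover have "exp (2 * K * (s - a)) * (u' s + 2 * K * u s) \<ge> 0"
      using u'_le[of s] s t by (auto simp: zero_le_mult_iff)
    ultimately show "\<exists>D. ((\<lambda>s. exp (2 * K * (s - a)) * u s) has_real_derivative D) (at s) \<and> D \<ge> 0"
      by blast
  qed (use t in \<open>auto intro!: continuous_intros cu\<close>)
  then have "u a \<le> (exp (K * (t - a)))\<^sup>2 * u t"
    by (simp add: sq)
  then have "(norm (x a - y a))\<^sup>2 \<le> (exp (K * (t - a)) * norm (x t - y t))\<^sup>2"
    by (simp add: u power_mult_distrib)
  then show "norm (x a - y a) \<le> exp (K * (t - a)) * norm (x t - y t)"
    by (rule power2_le_imp_le) simp
qed

text \<open>In the norm weighted by exp(-2 K t) the integral operator contracts by 1/2 on all of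
  [0,T] at once, whatever \<open>T\<close> is, so no short intervals have to be pasted
  together.\<close>

lemma picard_lindeloef:
  fixes X :: "'a::banach \<Rightarrow> 'a"
  assumes lip: "\<And>u w. norm (X u - X w) \<le> K * norm (u - w)" and K: "K > 0" and T: "T \<ge> 0"
  obtains x where "x 0 = p" "autonomous_solution X 0 T x"
proof -
  \<comment> \<open>The contraction acts on bounded continuous functions on the whole line; time is
    clamped to [0,T] to get there.\<close>
  define cl where "cl t = max 0 (min T t)" for t :: real
  have cl: "cl t \<in> {0..T}" "continuous_on UNIV cl" for t
    using T unfolding cl_def by (auto intro!: continuous_intros)
  have cX: "continuous_on S X" for S
    using lipschitz_on_continuous_on[of K S X] lip K by (auto simp: lipschitz_on_def dist_norm)
  \<comment> \<open>The unknown \<open>u\<close> stands for the solution divided by exp(2 K t);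
    multiplying back gives the argument of \<open>X\<close>.\<close>
  define w where "w u r = X (exp (2 * K * r) *\<^sub>R apply_bcontfun u r)" for u :: "real \<Rightarrow>\<^sub>C 'a" and r
  have cw: "continuous_on S (w u)" for S u
    unfolding w_def by (intro continuous_on_compose2[OF cX[of UNIV]] continuous_intros) auto
  have iw: "w u integrable_on {0..t}" for u t by (intro integrable_continuous_real cw)
  define f where "f u t = exp (- (2 * K) * t) *\<^sub>R (p + integral {0..t} (w u))" for u t
  have cf: "continuous_on {0..T} (f u)" for u
    unfolding f_def by (intro continuous_intros indefinite_integral_continuous_1 iw)
  have "(\<lambda>t. f u (cl t)) \<in> bcontfun" for u
  proof -
    have "continuous_on UNIV (\<lambda>t. f u (cl t))"
      by (rule continuous_on_compose2[OF cf cl(2)]) (use cl(1) in auto)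
    moreover have "bounded (f u ` {0..T})"
      by (intro compact_imp_bounded compact_continuous_image cf) auto
    then have "bounded (range (\<lambda>t. f u (cl t)))"
      by (rule bounded_subset) (use cl(1) in auto)
    ultimately show ?thesis by (simp add: bcontfun_def)
  qed
  then have P: "apply_bcontfun (Bcontfun (\<lambda>t. f u (cl t))) = (\<lambda>t. f u (cl t))" for u
    by (rule Bcontfun_inverse)
  have dist: "dist (f u t) (f v t) \<le> 1 / 2 * dist u v" if t: "t \<in> {0..T}" for u v t
  proof -
    have e: "((\<lambda>r. K * exp (2 * K * r)) has_integral (exp (2 * K * t) / 2 - exp (2 * K * 0) / 2)) {0..t}"
      using t K by (intro fundamental_theorem_of_calculus)
        (auto simp flip: has_real_derivative_iff_has_vector_derivative intro!: derivative_eq_intros)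
    have "norm (integral {0..t} (\<lambda>r. w u r - w v r)) \<le> integral {0..t} (\<lambda>r. K * exp (2 * K * r) * dist u v)"
    proof (rule integral_norm_bound_integral)
      fix r
      have "norm (w u r - w v r) \<le> K * norm (exp (2 * K * r) *\<^sub>R (apply_bcontfun u r - apply_bcontfun v r))"
        unfolding w_def scaleR_diff_right by (rule lip)
      also have "\<dots> \<le> K * (exp (2 * K * r) * dist u v)"
        using dist_bounded[of u r v] K by (simp add: dist_norm)
      finally show "norm (w u r - w v r) \<le> K * exp (2 * K * r) * dist u v" by simp
    qed (auto intro!: integrable_continuous_real continuous_intros cw)
    also have "\<dots> = (exp (2 * K * t) / 2 - 1 / 2) * dist u v"
      using integral_unique[OF has_integral_mult_left[OF e, of "dist u v"]] by simp
    also have "\<dots> \<le> exp (2 * K * t) / 2 * dist u v" by (intro mult_right_mono) auto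
    finally have "norm (integral {0..t} (w u) - integral {0..t} (w v)) \<le> exp (2 * K * t) / 2 * dist u v"
      by (simp add: integral_diff iw)
    then have "exp (- (2 * K) * t) * norm (integral {0..t} (w u) - integral {0..t} (w v))
        \<le> exp (- (2 * K) * t) * (exp (2 * K * t) / 2 * dist u v)"
      by (intro mult_left_mono) auto
    also have "\<dots> = (exp (- (2 * K) * t) * exp (2 * K * t)) / 2 * dist u v" by simp
    also have "\<dots> = 1 / 2 * dist u v" unfolding exp_add[symmetric] by simp
    finally have "norm (exp (- (2 * K) * t) *\<^sub>R (integral {0..t} (w u) - integral {0..t} (w v))) \<le> 1 / 2 * dist u v"
      by simp
    then show ?thesis by (simp add: f_def dist_norm algebra_simps)
  qed
  have "\<exists>!u. Bcontfun (\<lambda>t. f u (cl t)) = u"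
  proof (rule banach_fix_type[of "1 / 2"], goal_cases)
    case 3
    show ?case by (intro allI dist_bound) (simp only: P dist[OF cl(1)])
  qed auto
  then obtain u where "Bcontfun (\<lambda>t. f u (cl t)) = u" by blast
  then have "apply_bcontfun u t = f u (cl t)" for t by (metis P)
  then have u: "apply_bcontfun u t = f u t" if "t \<in> {0..T}" for t
    using that by (auto simp: cl_def)
  define x where "x t = p + integral {0..t} (w u)" for t
  have wX: "w u t = X (x t)" if "t \<in> {0..T}" for t
    unfolding w_def u[OF that] f_def x_def by (simp add: exp_add[symmetric])
  have "(x has_vector_derivative X (x t)) (at t within {0..T})" if "t \<in> {0..T}" for t
    unfolding wX[OF that, symmetric] unfolding x_def
    using integral_has_vector_derivative[OF cw that] by (auto intro!: derivative_eq_intros)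
  then have "autonomous_solution X 0 T x" by (simp add: autonomous_solution_def)
  moreover have "x 0 = p" by (simp add: x_def)
  ultimately show thesis using that by blast
qed

lemma autonomous_solution_shift:
  "autonomous_solution X (s + d) (T + d) x \<longleftrightarrow> autonomous_solution X s T (\<lambda>t. x (t + d))"
proof -
  have *: "(x has_vector_derivative D) (at (t + d) within {s + d..T + d}) \<longleftrightarrow>
      ((\<lambda>t. x (t + d)) has_vector_derivative D) (at t within {s..T})" for D t
  proof
    assume "(x has_vector_derivative D) (at (t + d) within {s + d..T + d})"
    then have "(x has_vector_derivative D) (at (t + d) within (\<lambda>t. t + d) ` {s..T})" by simp
    moreover have "((\<lambda>t. t + d) has_vector_derivative 1) (at t within {s..T})"
      by (auto intro!: derivative_eq_intros)
    ultimately show "((\<lambda>t. x (t + d)) has_vector_derivative D) (at t within {s..T})"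
      using vector_diff_chain_within[of "\<lambda>t. t + d" 1 t "{s..T}" x D] by (simp add: o_def)
  next
    assume "((\<lambda>t. x (t + d)) has_vector_derivative D) (at t within {s..T})"
    then have "((\<lambda>t. x (t + d)) has_vector_derivative D) (at (t + d - d) within (\<lambda>t. t - d) ` {s + d..T + d})" by simp
    moreover have "((\<lambda>t. t - d) has_vector_derivative 1) (at (t + d) within {s + d..T + d})"
      by (auto intro!: derivative_eq_intros)
    ultimately show "(x has_vector_derivative D) (at (t + d) within {s + d..T + d})"
      using vector_diff_chain_within[of "\<lambda>t. t - d" 1 "t + d" "{s + d..T + d}" "\<lambda>t. x (t + d)" D] by (simp add: o_def)
  qed
  have "autonomous_solution X (s + d) (T + d) x \<longleftrightarrow>
      (\<forall>t\<in>{s..T}. (x has_vector_derivative X (x (t + d))) (at (t + d) within {s + d..T + d}))"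
    unfolding autonomous_solution_def
    by (metis (no_types, opaque_lifting) add_le_cancel_right atLeastAtMost_iff diff_add_cancel)
  then show ?thesis by (simp add: * autonomous_solution_def)
qed

section \<open>Integral form of the equation and switching between two fields\<close>

lemma autonomous_solution_integral:
  fixes x :: "real \<Rightarrow> 'a::banach"
  assumes "autonomous_solution X a b x" "t \<in> {a..b}"
  shows "((\<lambda>s. X (x s)) has_integral x t - x a) {a..t}"
proof (rule fundamental_theorem_of_calculus)
  fix s assume "s \<in> {a..t}"
  then show "(x has_vector_derivative X (x s)) (at s within {a..t})"
    using autonomous_solution_subset[OF assms(1), of a t] assms(2)
    by (auto simp: autonomous_solution_def)
qed (use assms in auto)

lemma autonomous_solution_of_integral:
  fixes x :: "real \<Rightarrow> 'a::banach"
  assumes "continuous_on {a..b} x" "continuous_on UNIV X"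
    and "\<And>t. t \<in> {a..b} \<Longrightarrow> ((\<lambda>s. X (x s)) has_integral x t - x a) {a..t}"
  shows "autonomous_solution X a b x"
  unfolding autonomous_solution_def
proof
  fix t assume t: "t \<in> {a..b}"
  have "continuous_on {a..b} (\<lambda>s. X (x s))"
    by (rule continuous_on_compose2[OF assms(2,1)]) auto
  then have "((\<lambda>t. x a + integral {a..t} (\<lambda>s. X (x s))) has_vector_derivative X (x t)) (at t within {a..b})"
    using integral_has_vector_derivative[OF _ t] by (auto intro!: derivative_eq_intros)
  then show "(x has_vector_derivative X (x t)) (at t within {a..b})"
  proof (rule has_vector_derivative_transform[OF t, rotated])
    fix s assume "s \<in> {a..b}"
    from integral_unique[OF assms(3)[OF this]] show "x s = x a + integral {a..s} (\<lambda>s. X (x s))" by simp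
  qed
qed

text \<open>On each piece the stepwise field differs from the constant one at the final time only:
  at \<open>\<alpha>\<close> the weight has already switched, and at \<open>\<beta>\<close> the
  remainder wraps around to 0. One point does not change the integral.\<close>

lemma solves_ivp_on_stepwise:
  fixes X1 X2 :: "'a::euclidean_space \<Rightarrow> 'a"
  assumes \<alpha>: "0 < \<alpha>" "\<alpha> < \<beta>" and c: "continuous_on UNIV X1" "continuous_on UNIV X2"
    and X: "\<And>t. X t = (if t rmod \<beta> < \<alpha> then X1 else X2)"
  shows "solves_ivp_on X \<beta> z \<zeta> \<longleftrightarrow>
    \<zeta> 0 = z \<and> autonomous_solution X1 0 \<alpha> \<zeta> \<and> autonomous_solution X2 \<alpha> \<beta> \<zeta>"
proof -
  have m: "t rmod \<beta> = t" if "0 \<le> t" "t < \<beta>" for t using that by (intro rmod_idem) auto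
  have 1: "((\<lambda>s. X s (\<zeta> s)) has_integral I) {0..t} \<longleftrightarrow> ((\<lambda>s. X1 (\<zeta> s)) has_integral I) {0..t}"
    if "t \<in> {0..\<alpha>}" for t I
    by (rule has_integral_spike_finite_eq[of "{\<alpha>}"]) (use that \<alpha> in \<open>auto simp: X m\<close>)
  have 2: "((\<lambda>s. X s (\<zeta> s)) has_integral I) {\<alpha>..t} \<longleftrightarrow> ((\<lambda>s. X2 (\<zeta> s)) has_integral I) {\<alpha>..t}"
    if "t \<in> {\<alpha>..\<beta>}" for t I
    by (rule has_integral_spike_finite_eq[of "{\<beta>}"]) (use that \<alpha> in \<open>auto simp: X m\<close>)
  show ?thesis
  proof (intro iffI conjI)
    assume A: "solves_ivp_on X \<beta> z \<zeta>"
    then show z: "\<zeta> 0 = z" by (simp add: solves_ivp_on_def)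
    have c\<zeta>: "continuous_on {0..\<beta>} \<zeta>" and I: "\<And>t. t \<in> {0..\<beta>} \<Longrightarrow> ((\<lambda>s. X s (\<zeta> s)) has_integral (\<zeta> t - z)) {0..t}"
      using A by (auto simp: solves_ivp_on_def)
    show "autonomous_solution X1 0 \<alpha> \<zeta>"
    proof (rule autonomous_solution_of_integral)
      fix t assume "t \<in> {0..\<alpha>}"
      then show "((\<lambda>s. X1 (\<zeta> s)) has_integral \<zeta> t - \<zeta> 0) {0..t}"
        using I[of t] \<alpha> 1 z by auto
    qed (use \<alpha> c in \<open>auto intro: continuous_on_subset[OF c\<zeta>]\<close>)
    show "autonomous_solution X2 \<alpha> \<beta> \<zeta>"
    proof (rule autonomous_solution_of_integral)
      fix t assume t: "t \<in> {\<alpha>..\<beta>}"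
      have i: "(\<lambda>s. X s (\<zeta> s)) integrable_on {\<alpha>..t}"
        by (rule integrable_subinterval_real[OF has_integral_integrable[OF I[of t]]]) (use t \<alpha> in auto)
      have "((\<lambda>s. X s (\<zeta> s)) has_integral (\<zeta> \<alpha> - z) + integral {\<alpha>..t} (\<lambda>s. X s (\<zeta> s))) {0..t}"
        by (rule has_integral_combine[OF _ _ I[of \<alpha>] integrable_integral[OF i]]) (use t \<alpha> in auto)
      then have "(\<zeta> \<alpha> - z) + integral {\<alpha>..t} (\<lambda>s. X s (\<zeta> s)) = \<zeta> t - z"
        by (rule has_integral_unique) (use I[of t] t \<alpha> in auto)
      then have "integral {\<alpha>..t} (\<lambda>s. X s (\<zeta> s)) = \<zeta> t - \<zeta> \<alpha>" by (simp add: algebra_simps)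
      then show "((\<lambda>s. X2 (\<zeta> s)) has_integral \<zeta> t - \<zeta> \<alpha>) {\<alpha>..t}"
        using integrable_integral[OF i] 2[OF t] by simp
    qed (use \<alpha> c in \<open>auto intro: continuous_on_subset[OF c\<zeta>]\<close>)
  next
    assume A: "\<zeta> 0 = z \<and> autonomous_solution X1 0 \<alpha> \<zeta> \<and> autonomous_solution X2 \<alpha> \<beta> \<zeta>"
    have "continuous_on ({0..\<alpha>} \<union> {\<alpha>..\<beta>}) \<zeta>"
      using A by (intro continuous_on_closed_Un) (auto intro: autonomous_solution_continuous)
    moreover have "{0..\<alpha>} \<union> {\<alpha>..\<beta>} = {0..\<beta>}" using \<alpha> by auto
    ultimately have c\<zeta>: "continuous_on {0..\<beta>} \<zeta>" by simp
    have I1: "((\<lambda>s. X s (\<zeta> s)) has_integral (\<zeta> t - z)) {0..t}" if "t \<in> {0..\<alpha>}" for t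
      using autonomous_solution_integral[of X1 0 \<alpha> \<zeta> t] A that 1[OF that] by auto
    moreover have "((\<lambda>s. X s (\<zeta> s)) has_integral (\<zeta> t - z)) {0..t}" if t: "t \<in> {\<alpha>..\<beta>}" for t
    proof -
      have "((\<lambda>s. X s (\<zeta> s)) has_integral (\<zeta> t - \<zeta> \<alpha>)) {\<alpha>..t}"
        using autonomous_solution_integral[of X2 \<alpha> \<beta> \<zeta> t] A 2[OF t] t by auto
      from has_integral_combine[OF _ _ I1[of \<alpha>] this] show ?thesis using \<alpha> t by auto
    qed
    ultimately have "((\<lambda>s. X s (\<zeta> s)) has_integral (\<zeta> t - z)) {0..t}" if "t \<in> {0..\<beta>}" for t
      using that by (cases "t \<le> \<alpha>") auto
    then show "solves_ivp_on X \<beta> z \<zeta>" using A c\<zeta> by (simp add: solves_ivp_on_def)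
  qed
qed

lemma autonomous_solution_transform:
  assumes x: "autonomous_solution X s T x" and eq: "\<And>t. t \<in> {s..T} \<Longrightarrow> y t = x t"
  shows "autonomous_solution X s T y"
  unfolding autonomous_solution_def
proof
  fix t assume t: "t \<in> {s..T}"
  then have "(x has_vector_derivative X (y t)) (at t within {s..T})"
    using x eq by (simp add: autonomous_solution_def)
  then show "(y has_vector_derivative X (y t)) (at t within {s..T})"
    by (rule has_vector_derivative_transform[OF t eq, rotated])
qed

text \<open>Two solutions on a compact interval stay in a common ball, and a Lipschitz constant for
  that ball suffices. This is meant for the original field, which is only locally Lipschitz.\<close>

lemma autonomous_solution_unique:
  fixes X :: "'a::real_inner \<Rightarrow> 'a"
  assumes x: "autonomous_solution X s T x" and y: "autonomous_solution X s T y" and xy: "x s = y s"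
    and lip: "\<And>B. \<exists>K. \<forall>u w. norm u \<le> B \<longrightarrow> norm w \<le> B \<longrightarrow> norm (X u - X w) \<le> K * norm (u - w)"
    and t: "t \<in> {s..T}"
  shows "x t = y t"
proof -
  have "bounded (x ` {s..T} \<union> y ` {s..T})"
    using autonomous_solution_continuous[OF x] autonomous_solution_continuous[OF y]
    by (auto intro!: compact_imp_bounded compact_continuous_image)
  then obtain B where B: "\<And>r. r \<in> {s..T} \<Longrightarrow> norm (x r) \<le> B \<and> norm (y r) \<le> B"
    unfolding bounded_iff by blast
  obtain K where "\<And>u w. norm u \<le> B \<Longrightarrow> norm w \<le> B \<Longrightarrow> norm (X u - X w) \<le> K * norm (u - w)"
    using lip[of B] by blast
  then have "norm (X (x r) - X (y r)) \<le> K * norm (x r - y r)" if "r \<in> {s..T}" for r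
    using B[OF that] by blast
  from autonomous_solution_gronwall(1)[OF x y this t] show ?thesis by (simp add: xy)
qed

lemma C1_lipschitz_on_bounded:
  fixes F :: "real \<Rightarrow> real"
  assumes "F C1_differentiable_on UNIV"
  obtains K where "0 < K" "\<And>s t. \<bar>s\<bar> \<le> B \<Longrightarrow> \<bar>t\<bar> \<le> B \<Longrightarrow> \<bar>F s - F t\<bar> \<le> K * \<bar>s - t\<bar>"
proof -
  obtain D where D: "\<And>x. (F has_real_derivative D x) (at x)" "continuous_on UNIV D"
    using assms by (auto simp: C1_differentiable_on_def has_real_derivative_iff_has_vector_derivative)
  have "bounded (D ` {-B..B})"
    by (intro compact_imp_bounded compact_continuous_image continuous_on_subset[OF D(2)]) auto
  then obtain K where K: "0 < K" "\<And>x. x \<in> {-B..B} \<Longrightarrow> norm (D x) \<le> K" by (auto simp: bounded_pos)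
  have "\<bar>F s - F t\<bar> \<le> K * \<bar>s - t\<bar>" if "\<bar>s\<bar> \<le> B" "\<bar>t\<bar> \<le> B" for s t
    using field_differentiable_bound[of "{-B..B}" F D K s t] K(2) has_field_derivative_at_within[OF D(1)] that
    by (simp add: abs_le_iff)
  with K(1) show thesis using that by blast
qed

text \<open>The product of z with exp(- integral of z'/z) has derivative zero. The imaginary part of
  the integral is thus a continuous change of argument, free of any choice of branch.\<close>

lemma logarithmic_lift:
  fixes z z' :: "real \<Rightarrow> complex"
  assumes z: "\<And>t. t \<in> {0..T} \<Longrightarrow> (z has_vector_derivative z' t) (at t within {0..T})"
    and z': "continuous_on {0..T} z'" and nz: "\<And>t. t \<in> {0..T} \<Longrightarrow> z t \<noteq> 0"
    and t: "t \<in> {0..T}"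
  shows "z t = z 0 * exp (integral {0..t} (\<lambda>s. z' s / z s))"
proof -
  define I where "I t = integral {0..t} (\<lambda>s. z' s / z s)" for t
  have cz: "continuous_on {0..T} z"
    using z has_vector_derivative_continuous by (fastforce simp: continuous_on_eq_continuous_within)
  have I: "(I has_vector_derivative (z' t / z t)) (at t within {0..T})" if "t \<in> {0..T}" for t
    unfolding I_def using nz that by (intro integral_has_vector_derivative continuous_intros z' cz) auto
  have "((\<lambda>t. z t * exp (- I t)) has_vector_derivative 0) (at s within {0..T})" if s: "s \<in> {0..T}" for s
  proof -
    have "((\<lambda>t. exp (- I t)) has_vector_derivative (- (z' s / z s)) * exp (- I s)) (at s within {0..T})"
      using field_vector_diff_chain_within[OF has_vector_derivative_minus[OF I[OF s]], of exp "exp (- I s)"]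
      by (simp add: o_def DERIV_exp has_field_derivative_at_within)
    from has_vector_derivative_mult[OF z[OF s] this] show ?thesis using nz[OF s] by simp
  qed
  from has_vector_derivative_zero_constant[of "{0..T}", OF _ this]
  obtain c where c: "\<And>s. s \<in> {0..T} \<Longrightarrow> z s * exp (- I s) = c" by auto
  have "z t * exp (- I t) = z 0 * exp (- I 0)" using c[OF t] c[of 0] t by auto
  then show ?thesis by (simp add: I_def exp_minus field_simps)
qed

section \<open>The planar system with constant weight\<close>

text \<open>
  The force is frozen outside \<open>[0, 1]\<close>, which makes it globally Lipschitz and the flow global. The
  orbits of the horseshoe stay in \<open>0 \<le> v \<le> 1\<close>, where nothing has changed.
\<close>

definition unit_clamp :: "real \<Rightarrow> real" where
  "unit_clamp v = max 0 (min 1 v)"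

lemma unit_clamp: "unit_clamp v \<in> {0..1}" "0 \<le> unit_clamp v" "unit_clamp v \<le> 1"
  "v \<in> {0..1} \<Longrightarrow> unit_clamp v = v" "v \<le> 0 \<Longrightarrow> unit_clamp v = 0"
  "0 \<le> v \<Longrightarrow> unit_clamp v \<le> v"
  by (auto simp: unit_clamp_def)

lemma unit_clamp_lipschitz: "\<bar>unit_clamp v - unit_clamp w\<bar> \<le> \<bar>v - w\<bar>"
  by (auto simp: unit_clamp_def)

lemma continuous_on_unit_clamp: "continuous_on S unit_clamp"
  unfolding unit_clamp_def by (intro continuous_intros)

lemma antiderivative_on_reals:
  fixes f :: "real \<Rightarrow> real"
  assumes "continuous_on UNIV f"
  obtains G where "G 0 = 0" "\<And>v. (G has_real_derivative f v) (at v)"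
proof -
  have "\<exists>G. \<forall>x. -\<infinity> < ereal x \<longrightarrow> ereal x < \<infinity> \<longrightarrow> (G has_vector_derivative f x) (at x)"
    using assms by (intro einterval_antiderivative) (auto simp: continuous_on_eq_continuous_at)
  then obtain G where "\<And>x. (G has_real_derivative f x) (at x)"
    by (auto simp: has_real_derivative_iff_has_vector_derivative)
  then show thesis
    by (intro that[of "\<lambda>v. G v - G 0"]) (auto intro!: derivative_eq_intros)
qed

text \<open>The true field for a constant weight. The globally Lipschitz \<open>field\<close> below
  agrees with it for v in [0,1].\<close>

definition nagumo_field :: "real \<Rightarrow> (real \<Rightarrow> real) \<Rightarrow> real \<Rightarrow> real \<times> real \<Rightarrow> real \<times> real" where
  "nagumo_field g F n = (\<lambda>(v, y). (y, g * v - n * F v))"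

lemma nagumo_field_locally_lipschitz:
  assumes "F C1_differentiable_on UNIV"
  shows "\<exists>K. \<forall>u w. norm u \<le> B \<longrightarrow> norm w \<le> B \<longrightarrow>
    norm (nagumo_field g F n u - nagumo_field g F n w) \<le> K * norm (u - w)"
proof -
  obtain K where K: "0 < K" "\<And>s t. \<bar>s\<bar> \<le> B \<Longrightarrow> \<bar>t\<bar> \<le> B \<Longrightarrow> \<bar>F s - F t\<bar> \<le> K * \<bar>s - t\<bar>"
    using C1_lipschitz_on_bounded[OF assms] by blast
  have "norm (nagumo_field g F n u - nagumo_field g F n w) \<le> (1 + \<bar>g\<bar> + \<bar>n\<bar> * K) * norm (u - w)"
    if b: "norm u \<le> B" "norm w \<le> B" for u w
  proof -
    obtain v y v' y' where uw: "u = (v, y)" "w = (v', y')" by (metis surj_pair)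
    have le: "\<bar>v - v'\<bar> \<le> norm (u - w)" "\<bar>y - y'\<bar> \<le> norm (u - w)"
      using norm_fst_le[of "v - v'" "y - y'"] norm_snd_le[of "y - y'" "v - v'"] by (simp_all add: uw)
    have "\<bar>v\<bar> \<le> B" "\<bar>v'\<bar> \<le> B"
      using norm_fst_le[of v y] norm_fst_le[of v' y'] b by (simp_all add: uw)
    then have F: "\<bar>F v - F v'\<bar> \<le> K * norm (u - w)"
      using K(2)[of v v'] mult_left_mono[OF le(1), of K] K(1) by linarith
    have "norm (nagumo_field g F n u - nagumo_field g F n w) \<le> \<bar>y - y'\<bar> + \<bar>(g * v - n * F v) - (g * v' - n * F v')\<bar>"
      using norm_Pair_le[of "y - y'" "(g * v - n * F v) - (g * v' - n * F v')"] by (simp add: uw nagumo_field_def)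
    also have "(g * v - n * F v) - (g * v' - n * F v') = g * (v - v') - n * (F v - F v')"
      by (simp add: algebra_simps)
    also have "\<bar>y - y'\<bar> + \<bar>\<dots>\<bar> \<le> \<bar>y - y'\<bar> + (\<bar>g\<bar> * \<bar>v - v'\<bar> + \<bar>n\<bar> * \<bar>F v - F v'\<bar>)"
      by (simp add: abs_mult[symmetric] abs_triangle_ineq4)
    also have "\<dots> \<le> norm (u - w) + (\<bar>g\<bar> * norm (u - w) + \<bar>n\<bar> * (K * norm (u - w)))"
      by (intro add_mono mult_left_mono le F) auto
    finally show ?thesis by (simp add: algebra_simps)
  qed
  then show ?thesis by blast
qed

locale nagumo =
  fixes g a L :: real and F :: "real \<Rightarrow> real"
  assumes g: "0 < g" and a: "0 < a" "a < 1"
    and F_zero: "F 0 = 0" "F a = 0" "F 1 = 0"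
    and F_neg: "\<And>s. 0 < s \<Longrightarrow> s < a \<Longrightarrow> F s < 0"
    and F_pos: "\<And>s. a < s \<Longrightarrow> s < 1 \<Longrightarrow> F s > 0"
    and F_continuous: "continuous_on UNIV F"
    and F_integral: "integral {0..1} F > 0"
    and L: "0 < L"
    and F_lipschitz: "\<And>s t. s \<in> {0..1} \<Longrightarrow> t \<in> {0..1} \<Longrightarrow> \<bar>F s - F t\<bar> \<le> L * \<bar>s - t\<bar>"
begin

definition force :: "real \<Rightarrow> real \<Rightarrow> real" where
  "force n v = g * unit_clamp v - n * F (unit_clamp v)"

definition field :: "real \<Rightarrow> real \<times> real \<Rightarrow> real \<times> real" where
  "field n = (\<lambda>(v, y). (y, force n v))"

definition flow :: "real \<Rightarrow> real \<Rightarrow> real \<times> real \<Rightarrow> real \<Rightarrow> real \<times> real" where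
  "flow n T p = (SOME x. x 0 = p \<and> autonomous_solution (field n) 0 T x)"

lemma continuous_on_F [continuous_intros]:
  "continuous_on S h \<Longrightarrow> continuous_on S (\<lambda>x. F (h x))"
  by (rule continuous_on_compose2[OF F_continuous]) auto

lemma continuous_on_force [continuous_intros]:
  "continuous_on S h \<Longrightarrow> continuous_on S (\<lambda>x. force n (h x))"
  unfolding force_def
  by (intro continuous_intros continuous_on_compose2[OF continuous_on_unit_clamp[of UNIV]]) auto

lemma field_lipschitz:
  assumes "0 \<le> n"
  shows "norm (field n u - field n w) \<le> (1 + g + n * L) * norm (u - w)"
proof -
  obtain v y v' y' where uw: "u = (v, y)" "w = (v', y')" by (metis surj_pair)
  have le: "\<bar>v - v'\<bar> \<le> norm (u - w)" "\<bar>y - y'\<bar> \<le> norm (u - w)"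
    using norm_fst_le[of "v - v'" "y - y'"] norm_snd_le[of "y - y'" "v - v'"] by (simp_all add: uw)
  have "\<bar>force n v - force n v'\<bar> \<le> g * \<bar>unit_clamp v - unit_clamp v'\<bar>
      + n * \<bar>F (unit_clamp v) - F (unit_clamp v')\<bar>"
  proof -
    have "force n v - force n v' = g * (unit_clamp v - unit_clamp v') - n * (F (unit_clamp v) - F (unit_clamp v'))"
      by (simp add: force_def algebra_simps)
    then show ?thesis using g assms by (metis abs_mult abs_of_nonneg abs_of_pos abs_triangle_ineq4)
  qed
  also have "\<dots> \<le> g * \<bar>v - v'\<bar> + n * (L * \<bar>v - v'\<bar>)"
    using F_lipschitz[OF unit_clamp(1) unit_clamp(1), of v v'] unit_clamp_lipschitz[of v v'] g assms L
    by (intro add_mono mult_left_mono) (auto intro: order_trans)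
  also have "\<dots> \<le> (g + n * L) * norm (u - w)"
    using mult_left_mono[OF le(1), of "g + n * L"] g assms L by (simp add: algebra_simps)
  finally have f: "\<bar>force n v - force n v'\<bar> \<le> (g + n * L) * norm (u - w)" .
  have "norm (field n u - field n w) \<le> \<bar>y - y'\<bar> + \<bar>force n v - force n v'\<bar>"
    using norm_Pair_le[of "y - y'" "force n v - force n v'"] by (simp add: uw field_def)
  with f le(2) show ?thesis by (simp add: algebra_simps)
qed

lemma flow:
  assumes "0 \<le> n" "0 \<le> T"
  shows "flow n T p 0 = p" "autonomous_solution (field n) 0 T (flow n T p)"
proof -
  have "0 < 1 + g + n * L" using g L assms by (simp add: add_pos_nonneg)
  then have "\<exists>x. x 0 = p \<and> autonomous_solution (field n) 0 T x"
    using picard_lindeloef[of "field n" "1 + g + n * L" T p] field_lipschitz[OF assms(1)] assms(2) by blast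
  from someI_ex[OF this] show "flow n T p 0 = p" "autonomous_solution (field n) 0 T (flow n T p)"
    by (auto simp: flow_def)
qed

lemma flow_lipschitz:
  assumes "0 \<le> n" "0 \<le> T" "t \<in> {0..T}"
  shows "norm (flow n T p t - flow n T q t) \<le> exp ((1 + g + n * L) * T) * norm (p - q)"
    and "norm (p - q) \<le> exp ((1 + g + n * L) * T) * norm (flow n T p t - flow n T q t)"
proof -
  have "exp ((1 + g + n * L) * t) \<le> exp ((1 + g + n * L) * T)"
    using assms g L by (auto intro!: mult_left_mono add_nonneg_nonneg)
  then have *: "exp ((1 + g + n * L) * t) * norm r \<le> exp ((1 + g + n * L) * T) * norm r" for r :: "real \<times> real"
    by (rule mult_right_mono) simp
  note gr = autonomous_solution_gronwall[OF flow(2)[OF assms(1,2)] flow(2)[OF assms(1,2)]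
      field_lipschitz[OF assms(1)] assms(3), of p q, unfolded flow(1)[OF assms(1,2)], simplified]
  show "norm (flow n T p t - flow n T q t) \<le> exp ((1 + g + n * L) * T) * norm (p - q)"
    by (rule order_trans[OF gr(1) *])
  show "norm (p - q) \<le> exp ((1 + g + n * L) * T) * norm (flow n T p t - flow n T q t)"
    by (rule order_trans[OF gr(2) *])
qed

lemma flow_inj:
  assumes "0 \<le> n" "0 \<le> T" "t \<in> {0..T}" "flow n T p t = flow n T q t"
  shows "p = q"
  using flow_lipschitz(2)[OF assms(1-3), of p q] assms(4) by simp

lemma flow_equilibrium:
  assumes "0 \<le> n" "0 \<le> T" "t \<in> {0..T}"
  shows "flow n T (0, 0) t = (0, 0)"
proof -
  have "field n (0, 0) = 0"
    by (simp add: field_def force_def unit_clamp_def F_zero zero_prod_def)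
  then have "autonomous_solution (field n) 0 T (\<lambda>_. (0, 0))"
    by (simp add: autonomous_solution_def)
  from autonomous_solution_gronwall(1)[OF flow(2)[OF assms(1,2)] this field_lipschitz[OF assms(1)] assms(3), of "(0, 0)"]
  show ?thesis using assms by (simp add: flow)
qed

lemma continuous_on_flow:
  assumes "0 \<le> n" "0 \<le> T"
  shows "continuous_on (S \<times> {0..T}) (\<lambda>(p, t). flow n T p t)"
proof -
  define K where "K = exp ((1 + g + n * L) * T)"
  have "((\<lambda>(q, s). flow n T q s) \<longlongrightarrow> flow n T p t) (at (p, t) within S \<times> {0..T})"
    if pt: "(p, t) \<in> S \<times> {0..T}" for p t
  proof -
    let ?F = "at (p, t) within S \<times> {0..T}"
    have "continuous_on (S \<times> {0..T}) (\<lambda>q. flow n T p (snd q))"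
      by (rule continuous_on_compose2[OF autonomous_solution_continuous[OF flow(2)[OF assms]]])
         (auto intro!: continuous_intros)
    then have 1: "((\<lambda>q. flow n T p (snd q)) \<longlongrightarrow> flow n T p t) ?F"
      using pt by (force simp: continuous_on_def)
    have 2: "((\<lambda>q. flow n T (fst q) (snd q) - flow n T p (snd q)) \<longlongrightarrow> 0) ?F"
    proof (rule Lim_null_comparison)
      show "\<forall>\<^sub>F q in ?F. norm (flow n T (fst q) (snd q) - flow n T p (snd q)) \<le> K * norm (fst q - p)"
        unfolding eventually_at_filter K_def
        by (rule always_eventually) (use flow_lipschitz(1)[OF assms] in auto)
      have "((\<lambda>q. K * norm (fst q - p)) \<longlongrightarrow> K * norm (fst (p, t) - p)) ?F"
        by (intro tendsto_intros)
      then show "((\<lambda>q. K * norm (fst q - p)) \<longlongrightarrow> 0) ?F" by simp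
    qed
    from tendsto_add[OF 2 1] show ?thesis by (simp add: case_prod_unfold)
  qed
  then show ?thesis by (fastforce simp: continuous_on_def)
qed

lemma flow_end_continuous:
  assumes "0 \<le> n" "0 \<le> T"
  shows "continuous_on S (\<lambda>p. flow n T p T)"
proof -
  have "continuous_on S (\<lambda>p. (\<lambda>(p, t). flow n T p t) (p, T))"
    by (rule continuous_on_compose2[OF continuous_on_flow[OF assms, of S]])
      (use assms in \<open>auto intro!: continuous_intros\<close>)
  then show ?thesis by simp
qed

lemma solution_components:
  assumes "autonomous_solution (field n) 0 T x"
  shows "continuous_on {0..T} (\<lambda>t. fst (x t))" "continuous_on {0..T} (\<lambda>t. snd (x t))"
    and "0 < t \<Longrightarrow> t < T \<Longrightarrow> ((\<lambda>t. fst (x t)) has_real_derivative snd (x t)) (at t)"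
    and "0 < t \<Longrightarrow> t < T \<Longrightarrow> ((\<lambda>t. snd (x t)) has_real_derivative force n (fst (x t))) (at t)"
proof -
  show "continuous_on {0..T} (\<lambda>t. fst (x t))" "continuous_on {0..T} (\<lambda>t. snd (x t))"
    using autonomous_solution_continuous[OF assms] by (auto intro!: continuous_intros)
  assume "0 < t" "t < T"
  from autonomous_solution_at[OF assms this]
  have *: "(x has_derivative (\<lambda>h. h *\<^sub>R field n (x t))) (at t)" by (simp add: has_vector_derivative_def)
  show "((\<lambda>t. fst (x t)) has_real_derivative snd (x t)) (at t)"
    using has_derivative_fst[OF *] unfolding has_field_derivative_def
    by (rule has_derivative_eq_rhs) (auto simp: field_def case_prod_beta)
  show "((\<lambda>t. snd (x t)) has_real_derivative force n (fst (x t))) (at t)"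
    using has_derivative_snd[OF *] unfolding has_field_derivative_def
    by (rule has_derivative_eq_rhs) (auto simp: field_def case_prod_beta)
qed

text \<open>The force is nonnegative, so the speed never decreases and, starting from y >= 0,
  neither does the position; the linear estimates integrate this. The exponential one holds because
  force <= k v makes v + y grow at rate at most 1 + k; it controls points that start at rest near
  the origin.\<close>

lemma push:
  assumes sol: "autonomous_solution (field n) 0 T x" and T: "0 \<le> T" and k: "0 \<le> k"
    and force: "\<And>s. s \<in> {0..1} \<Longrightarrow> 0 \<le> g * s - n * F s \<and> g * s - n * F s \<le> k * s"
    and init: "0 \<le> fst (x 0)" "0 \<le> snd (x 0)"
  shows "snd (x 0) \<le> snd (x T)" "snd (x T) \<le> snd (x 0) + k * T"
    and "fst (x 0) + snd (x 0) * T \<le> fst (x T)" "fst (x T) \<le> fst (x 0) + snd (x T) * T"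
    and "\<And>t. t \<in> {0..T} \<Longrightarrow> fst (x 0) \<le> fst (x t) \<and> fst (x t) \<le> fst (x T)"
    and "snd (x 0) = 0 \<Longrightarrow> fst (x T) \<le> fst (x 0) * exp ((1 + k) * T)"
proof -
  note D = solution_components[OF sol]
  have C: "continuous_on {s..t} (\<lambda>t. fst (x t))" "continuous_on {s..t} (\<lambda>t. snd (x t))"
    if "0 \<le> s" "t \<le> T" for s t
    using that by (auto intro: continuous_on_subset[OF D(1)] continuous_on_subset[OF D(2)])
  have f: "0 \<le> force n v" "force n v \<le> k * unit_clamp v" "force n v \<le> k" for v
  proof -
    show "0 \<le> force n v" and *: "force n v \<le> k * unit_clamp v"
      using force[OF unit_clamp(1)[of v]] by (auto simp: force_def)
    note *
    also have "\<dots> \<le> k" using k unit_clamp(2,3)[of v] by (simp add: mult_left_le)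
    finally show "force n v \<le> k" .
  qed
  have snd_mono: "snd (x s) \<le> snd (x t)" if "0 \<le> s" "s \<le> t" "t \<le> T" for s t
  proof (rule DERIV_nonneg_imp_increasing_open[where f = "\<lambda>t. snd (x t)"])
    fix r assume "s < r" "r < t"
    then have "((\<lambda>t. snd (x t)) has_real_derivative force n (fst (x r))) (at r)"
      using that by (auto intro: D(4))
    then show "\<exists>y. ((\<lambda>t. snd (x t)) has_real_derivative y) (at r) \<and> 0 \<le> y" using f(1) by blast
  qed (use that in \<open>auto intro: C\<close>)
  have fst_mono: "fst (x s) \<le> fst (x t)" if "0 \<le> s" "s \<le> t" "t \<le> T" for s t
  proof (rule DERIV_nonneg_imp_increasing_open[where f = "\<lambda>t. fst (x t)"])
    fix r assume "s < r" "r < t"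
    then have "0 \<le> snd (x r)" "((\<lambda>t. fst (x t)) has_real_derivative snd (x r)) (at r)"
      using snd_mono[of 0 r] init(2) that by (auto intro: D(3))
    then show "\<exists>y. ((\<lambda>t. fst (x t)) has_real_derivative y) (at r) \<and> 0 \<le> y" by blast
  qed (use that in \<open>auto intro: C\<close>)
  show "snd (x 0) \<le> snd (x T)" using snd_mono T by simp
  show "fst (x 0) \<le> fst (x t) \<and> fst (x t) \<le> fst (x T)" if "t \<in> {0..T}" for t
    using fst_mono that by auto
  have "snd (x T) - k * T \<le> snd (x 0) - k * 0"
  proof (rule DERIV_nonpos_imp_decreasing_open[where f = "\<lambda>t. snd (x t) - k * t"])
    fix t assume t: "0 < t" "t < T"
    have "((\<lambda>t. snd (x t) - k * t) has_real_derivative force n (fst (x t)) - k) (at t)"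
      using t by (auto intro!: derivative_eq_intros D(4))
    then show "\<exists>y. ((\<lambda>t. snd (x t) - k * t) has_real_derivative y) (at t) \<and> y \<le> 0"
      using f(3) by force
  qed (use T in \<open>auto intro!: continuous_intros autonomous_solution_continuous[OF sol]\<close>)
  then show "snd (x T) \<le> snd (x 0) + k * T" by simp
  have "fst (x 0) - snd (x 0) * 0 \<le> fst (x T) - snd (x 0) * T"
  proof (rule DERIV_nonneg_imp_increasing_open[where f = "\<lambda>t. fst (x t) - snd (x 0) * t"])
    fix t assume t: "0 < t" "t < T"
    have "((\<lambda>t. fst (x t) - snd (x 0) * t) has_real_derivative snd (x t) - snd (x 0)) (at t)"
      using t by (auto intro!: derivative_eq_intros D(3))
    then show "\<exists>y. ((\<lambda>t. fst (x t) - snd (x 0) * t) has_real_derivative y) (at t) \<and> 0 \<le> y"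
      using snd_mono[of 0 t] t by force
  qed (use T in \<open>auto intro!: continuous_intros autonomous_solution_continuous[OF sol]\<close>)
  then show "fst (x 0) + snd (x 0) * T \<le> fst (x T)" by simp
  have "fst (x T) - snd (x T) * T \<le> fst (x 0) - snd (x T) * 0"
  proof (rule DERIV_nonpos_imp_decreasing_open[where f = "\<lambda>t. fst (x t) - snd (x T) * t"])
    fix t assume t: "0 < t" "t < T"
    have "((\<lambda>t. fst (x t) - snd (x T) * t) has_real_derivative snd (x t) - snd (x T)) (at t)"
      using t by (auto intro!: derivative_eq_intros D(3))
    then show "\<exists>y. ((\<lambda>t. fst (x t) - snd (x T) * t) has_real_derivative y) (at t) \<and> y \<le> 0"
      using snd_mono[of t T] t by force
  qed (use T in \<open>auto intro!: continuous_intros autonomous_solution_continuous[OF sol]\<close>)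
  then show "fst (x T) \<le> fst (x 0) + snd (x T) * T" by simp
  assume y0: "snd (x 0) = 0"
  let ?h = "\<lambda>t. exp (- (1 + k) * t) * (fst (x t) + snd (x t))"
  have "?h T \<le> ?h 0"
  proof (rule DERIV_nonpos_imp_decreasing_open[where f = ?h])
    fix t assume t: "0 < t" "t < T"
    have "(?h has_real_derivative exp (- (1 + k) * t) *
        (snd (x t) + force n (fst (x t)) - (1 + k) * (fst (x t) + snd (x t)))) (at t)"
      using t by (auto intro!: derivative_eq_intros D(3,4) simp: algebra_simps)
    moreover have "0 \<le> fst (x t)" "0 \<le> snd (x t)"
      using fst_mono[of 0 t] snd_mono[of 0 t] t init by auto
    then have "force n (fst (x t)) \<le> k * fst (x t)" "0 \<le> k * snd (x t)"
      using f(2)[of "fst (x t)"] mult_left_mono[OF unit_clamp(6) k] k by (auto intro: order_trans)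
    then have "snd (x t) + force n (fst (x t)) - (1 + k) * (fst (x t) + snd (x t)) \<le> 0"
      using \<open>0 \<le> fst (x t)\<close> by (simp add: algebra_simps)
    then have "exp (- (1 + k) * t) * (snd (x t) + force n (fst (x t)) - (1 + k) * (fst (x t) + snd (x t))) \<le> 0"
      by (intro mult_nonneg_nonpos) auto
    ultimately show "\<exists>y. (?h has_real_derivative y) (at t) \<and> y \<le> 0" by blast
  qed (use T in \<open>auto intro!: continuous_intros autonomous_solution_continuous[OF sol]\<close>)
  then have "exp (- (1 + k) * T) * (fst (x T) + snd (x T)) \<le> fst (x 0)" using y0 by simp
  moreover have "exp (- (1 + k) * T) * fst (x T) \<le> exp (- (1 + k) * T) * (fst (x T) + snd (x T))"
    using snd_mono[of 0 T] T init by (intro mult_left_mono) auto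
  ultimately have "exp (- (1 + k) * T) * fst (x T) \<le> fst (x 0)" by (rule order_trans[rotated])
  then have "exp ((1 + k) * T) * (exp (- (1 + k) * T) * fst (x T)) \<le> exp ((1 + k) * T) * fst (x 0)"
    by (rule mult_left_mono) auto
  moreover have "exp ((1 + k) * T) * (exp (- (1 + k) * T) * fst (x T)) = fst (x T)"
    unfolding mult.assoc[symmetric] exp_add[symmetric] by (simp add: algebra_simps)
  ultimately show "fst (x T) \<le> fst (x 0) * exp ((1 + k) * T)" by (metis mult.commute)
qed

section \<open>Energy and trapping inside the homoclinic loop\<close>

definition prim :: "real \<Rightarrow> real" where
  "prim = (SOME G. G 0 = 0 \<and> (\<forall>v. (G has_real_derivative F (unit_clamp v)) (at v)))"

definition half_sq :: "real \<Rightarrow> real" where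
  "half_sq = (SOME G. G 0 = 0 \<and> (\<forall>v. (G has_real_derivative unit_clamp v) (at v)))"

definition pot :: "real \<Rightarrow> real \<Rightarrow> real" where
  "pot n v = n * prim v - g * half_sq v"

definition energy :: "real \<Rightarrow> real \<times> real \<Rightarrow> real" where
  "energy n p = (snd p)\<^sup>2 / 2 + pot n (fst p)"

lemma prim: "prim 0 = 0" "(prim has_real_derivative F (unit_clamp v)) (at v)"
proof -
  have "\<exists>G. G 0 = 0 \<and> (\<forall>v. (G has_real_derivative F (unit_clamp v)) (at v))"
    by (rule antiderivative_on_reals[of "\<lambda>v. F (unit_clamp v)"])
      (auto intro!: continuous_intros continuous_on_unit_clamp)
  from someI_ex[OF this] show "prim 0 = 0" "(prim has_real_derivative F (unit_clamp v)) (at v)"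
    by (auto simp: prim_def)
qed

lemma half_sq: "half_sq 0 = 0" "(half_sq has_real_derivative unit_clamp v) (at v)"
proof -
  have "\<exists>G. G 0 = 0 \<and> (\<forall>v. (G has_real_derivative unit_clamp v) (at v))"
    by (rule antiderivative_on_reals[of unit_clamp]) (auto intro!: continuous_on_unit_clamp)
  from someI_ex[OF this] show "half_sq 0 = 0" "(half_sq has_real_derivative unit_clamp v) (at v)"
    by (auto simp: half_sq_def)
qed

lemma continuous_on_prim [continuous_intros]:
  "continuous_on S h \<Longrightarrow> continuous_on S (\<lambda>x. prim (h x))"
  by (rule continuous_on_compose2[OF DERIV_continuous_on[OF has_field_derivative_at_within[OF prim(2)], of UNIV]]) auto

lemma continuous_on_half_sq [continuous_intros]:
  "continuous_on S h \<Longrightarrow> continuous_on S (\<lambda>x. half_sq (h x))"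
  by (rule continuous_on_compose2[OF DERIV_continuous_on[OF has_field_derivative_at_within[OF half_sq(2)], of UNIV]]) auto

lemma continuous_on_energy: "continuous_on S (energy n)"
  unfolding energy_def pot_def by (auto intro!: continuous_intros)

lemma prim_decreasing: "0 \<le> u \<Longrightarrow> u < v \<Longrightarrow> v \<le> a \<Longrightarrow> prim v < prim u"
proof (rule DERIV_neg_imp_decreasing_open[where f = prim])
  fix s assume "0 \<le> u" "v \<le> a" "u < s" "s < v"
  then show "\<exists>y. (prim has_real_derivative y) (at s) \<and> y < 0"
    using prim(2)[of s] unit_clamp(4)[of s] F_neg[of s] a by auto
qed (auto intro!: continuous_intros)

lemma prim_increasing: "a \<le> u \<Longrightarrow> u < v \<Longrightarrow> v \<le> 1 \<Longrightarrow> prim u < prim v"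
proof (rule DERIV_pos_imp_increasing_open[where f = prim])
  fix s assume "a \<le> u" "v \<le> 1" "u < s" "s < v"
  then show "\<exists>y. (prim has_real_derivative y) (at s) \<and> 0 < y"
    using prim(2)[of s] unit_clamp(4)[of s] F_pos[of s] a by auto
qed (auto intro!: continuous_intros)

lemma prim_ge: "v \<in> {0..1} \<Longrightarrow> prim a \<le> prim v"
  using prim_decreasing[of v a] prim_increasing[of a v] by (cases v a rule: linorder_cases) auto

text \<open>The positive integral of \<open>F\<close> enters here. For a large weight it lifts the
  potential above 0 at a point before v = 1, so the loop turns back there.\<close>

lemma prim_one: "prim 1 > 0"
proof -
  have "(F has_integral prim 1 - prim 0) {0..1}"
  proof (rule fundamental_theorem_of_calculus)
    fix x :: real assume "x \<in> {0..1}"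
    then show "(prim has_vector_derivative F x) (at x within {0..1})"
      using prim(2)[of x] unit_clamp(4)[of x]
      by (simp add: has_field_derivative_at_within flip: has_real_derivative_iff_has_vector_derivative)
  qed auto
  then show ?thesis using F_integral prim(1) by (simp add: integral_unique)
qed

lemma prim_nonpos_arg: "v \<le> 0 \<Longrightarrow> prim v = 0"
proof (cases "v = 0")
  case False
  assume v: "v \<le> 0"
  have "prim 0 = prim v"
  proof (rule DERIV_isconst_end[where f = prim])
    fix x assume "v < x" "x < 0"
    then show "(prim has_real_derivative 0) (at x)" using prim(2)[of x] unit_clamp(5)[of x] F_zero by simp
  qed (use v False in \<open>auto intro!: continuous_intros\<close>)
  then show ?thesis by (simp add: prim)
qed (simp add: prim)

lemma half_sq_nonpos_arg: "v \<le> 0 \<Longrightarrow> half_sq v = 0"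
proof (cases "v = 0")
  case False
  assume v: "v \<le> 0"
  have "half_sq 0 = half_sq v"
  proof (rule DERIV_isconst_end[where f = half_sq])
    fix x assume "v < x" "x < 0"
    then show "(half_sq has_real_derivative 0) (at x)" using half_sq(2)[of x] unit_clamp(5)[of x] F_zero by simp
  qed (use v False in \<open>auto intro!: continuous_intros\<close>)
  then show ?thesis by (simp add: half_sq)
qed (simp add: half_sq)

lemma half_sq_mono: "u \<le> v \<Longrightarrow> half_sq u \<le> half_sq v"
  using half_sq(2) unit_clamp(2) by (intro DERIV_nonneg_imp_nondecreasing[where f = half_sq]) blast+

lemma half_sq_bounds: "v \<in> {0..1} \<Longrightarrow> half_sq v \<in> {0..1 / 2}"
proof -
  assume v: "v \<in> {0..1}"
  have "0\<^sup>2 / 2 - half_sq 0 \<le> v\<^sup>2 / 2 - half_sq v"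
  proof (rule DERIV_nonneg_imp_nondecreasing[where f = "\<lambda>v. v\<^sup>2 / 2 - half_sq v"])
    fix x :: real assume "0 \<le> x"
    then show "\<exists>y. ((\<lambda>v. v\<^sup>2 / 2 - half_sq v) has_real_derivative y) (at x) \<and> 0 \<le> y"
      using unit_clamp(6)[of x] by (intro exI[of _ "x - unit_clamp x"]) (auto intro!: derivative_eq_intros half_sq)
  qed (use v in auto)
  moreover have "v\<^sup>2 \<le> 1" using v by (simp add: abs_square_le_1)
  ultimately show ?thesis using half_sq_mono[of 0 v] v half_sq(1) by auto
qed

lemma pot_nonpos_arg: "v \<le> 0 \<Longrightarrow> pot n v = 0"
  by (simp add: pot_def prim_nonpos_arg half_sq_nonpos_arg)

lemma pot_decreasing: "0 < n \<Longrightarrow> 0 \<le> u \<Longrightarrow> u < v \<Longrightarrow> v \<le> a \<Longrightarrow> pot n v < pot n u"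
  using mult_strict_left_mono[OF prim_decreasing[of u v], of n] mult_left_mono[OF half_sq_mono[of u v], of g] g
  unfolding pot_def by linarith

lemma pot_derivative: "(pot n has_real_derivative - force n v) (at v)"
  unfolding pot_def[abs_def] force_def
  by (auto intro!: derivative_eq_intros prim half_sq)

lemma energy_conserved:
  assumes x: "autonomous_solution (field n) 0 T x" and t: "t \<in> {0..T}"
  shows "energy n (x t) = energy n (x 0)"
proof (cases "t = 0")
  case False
  note D = solution_components[OF x]
  show ?thesis
  proof (rule DERIV_isconst2[of 0 T "\<lambda>t. energy n (x t)"])
    show "continuous_on {0..T} (\<lambda>t. energy n (x t))"
      by (rule continuous_on_compose2[OF continuous_on_energy autonomous_solution_continuous[OF x]]) auto
    fix s assume s: "0 < s" "s < T"
    show "((\<lambda>t. energy n (x t)) has_real_derivative 0) (at s)"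
      unfolding energy_def
      by (auto intro!: derivative_eq_intros D(3,4) DERIV_chain2[OF pot_derivative] s simp: algebra_simps)
  qed (use t False in auto)
qed auto

text \<open>On the right the potential at \<open>cp\<close> exceeds the energy. On the left, energy
  <= 0 at v = 0 forces y = 0, the equilibrium, which no other orbit reaches in finite time because
  the flow is injective.\<close>

lemma trapped:
  assumes n: "0 < n" and cp: "0 < pot n cp" and p: "0 < fst p" "fst p < cp" "energy n p \<le> 0"
    and t: "t \<in> {0..T}"
  shows "0 < fst (flow n T p t)" "fst (flow n T p t) < cp"
proof -
  have T: "0 \<le> n" "0 \<le> T" using n t by auto
  let ?x = "flow n T p"
  note sol = flow[OF T, of p]
  have E: "energy n (?x s) \<le> 0" if "s \<in> {0..T}" for s
    using energy_conserved[OF sol(2) that] sol(1) p(3) by simp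
  have c: "continuous_on {0..t} (\<lambda>t. fst (?x t))"
    by (rule continuous_on_subset[OF solution_components(1)[OF sol(2)]]) (use t in auto)
  show "fst (?x t) < cp"
  proof (rule ccontr)
    assume "\<not> fst (?x t) < cp"
    then obtain s where "0 \<le> s" "s \<le> t" "fst (?x s) = cp"
      using IVT'[of "\<lambda>t. fst (?x t)" 0 cp t] c sol(1) p(2) t by auto
    then have "(snd (?x s))\<^sup>2 / 2 + pot n cp \<le> 0" using E[of s] t by (simp add: energy_def)
    then show False using cp zero_le_power2[of "snd (?x s)"] by linarith
  qed
  show "0 < fst (?x t)"
  proof (rule ccontr)
    assume "\<not> 0 < fst (?x t)"
    then obtain s where s: "0 \<le> s" "s \<le> t" "fst (?x s) = 0"
      using IVT2'[of "\<lambda>t. fst (?x t)" t 0 0] c sol(1) p(1) t by auto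
    then have "(snd (?x s))\<^sup>2 \<le> 0" using E[of s] t by (simp add: energy_def pot_nonpos_arg)
    then have "?x s = flow n T (0, 0) s" using s t flow_equilibrium[OF T, of s] by (simp add: prod_eq_iff)
    then have "p = (0, 0)" using flow_inj[OF T, of s] s t by auto
    then show False using p(1) by simp
  qed
qed

section \<open>The polar angle around the point (a, 0)\<close>

definition scaled :: "real \<Rightarrow> real \<times> real \<Rightarrow> complex" where
  "scaled n p = Complex (fst p - a) (snd p / sqrt n)"

definition scaled_velocity :: "real \<Rightarrow> real \<times> real \<Rightarrow> complex" where
  "scaled_velocity n p = Complex (snd p) (force n (fst p) / sqrt n)"

text \<open>
  A continuous lift of the polar angle at \<open>(a, 0)\<close> along an orbit. The velocity is divided by \<open>sqrt n\<close>
  so that the energy levels keep a bounded shape as \<open>n\<close> grows.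
\<close>

definition angle :: "real \<Rightarrow> real \<Rightarrow> real \<times> real \<Rightarrow> real \<Rightarrow> real" where
  "angle n T p t = Arg (scaled n p) +
     Im (integral {0..t} (\<lambda>s. scaled_velocity n (flow n T p s) / scaled n (flow n T p s)))"

lemma continuous_on_scaled [continuous_intros]:
  "continuous_on S h \<Longrightarrow> continuous_on S (\<lambda>x. scaled n (h x))"
  "continuous_on S h \<Longrightarrow> continuous_on S (\<lambda>x. scaled_velocity n (h x))"
  unfolding scaled_def scaled_velocity_def Complex_eq divide_inverse by (auto intro!: continuous_intros)

lemma scaled_nonzero:
  assumes "0 < n" "pot n a < energy n p"
  shows "scaled n p \<noteq> 0"
  using assms by (auto simp: scaled_def complex_eq_iff energy_def)

text \<open>An energy above \<open>pot n a\<close> keeps the orbit away from (a, 0), where no angle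
  exists; \<open>logarithmic_lift\<close> then applies to the rescaled orbit as a complex
  curve.\<close>

lemma angle_polar:
  assumes n: "0 < n" and E: "pot n a < energy n p" and t: "t \<in> {0..T}"
  defines "x \<equiv> flow n T p"
  shows "\<exists>r>0. fst (x t) - a = r * cos (angle n T p t) \<and> snd (x t) / sqrt n = r * sin (angle n T p t)"
proof -
  have T: "0 \<le> n" "0 \<le> T" using n t by auto
  have sol: "x 0 = p" "autonomous_solution (field n) 0 T x" using flow[OF T] by (auto simp: x_def)
  have nz: "scaled n (x s) \<noteq> 0" if "s \<in> {0..T}" for s
    using scaled_nonzero[OF n] E energy_conserved[OF sol(2) that] sol(1) by simp
  have cx: "continuous_on {0..T} x" using autonomous_solution_continuous[OF sol(2)] .
  have dz: "((\<lambda>s. scaled n (x s)) has_vector_derivative scaled_velocity n (x s)) (at s within {0..T})"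
    if "s \<in> {0..T}" for s
  proof -
    have "(x has_derivative (\<lambda>h. h *\<^sub>R field n (x s))) (at s within {0..T})"
      using sol(2) that by (simp add: autonomous_solution_def has_vector_derivative_def)
    from has_derivative_fst[OF this] has_derivative_snd[OF this]
    have "((\<lambda>s. fst (x s)) has_vector_derivative snd (x s)) (at s within {0..T})"
      "((\<lambda>s. snd (x s)) has_vector_derivative force n (fst (x s))) (at s within {0..T})"
      by (simp_all add: has_vector_derivative_def field_def case_prod_beta)
    then show ?thesis unfolding scaled_def scaled_velocity_def
      by (auto intro!: derivative_eq_intros simp: has_vector_derivative_complex_iff
        has_real_derivative_iff_has_vector_derivative divide_inverse)
  qed
  define I where "I = integral {0..t} (\<lambda>s. scaled_velocity n (x s) / scaled n (x s))"
  have "scaled n (x t) = scaled n p * exp I"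
    using logarithmic_lift[OF dz _ nz t] sol(1) by (auto simp: I_def intro!: continuous_intros cx)
  also have "\<dots> = of_real (cmod (scaled n p)) * cis (Arg (scaled n p)) * (of_real (exp (Re I)) * cis (Im I))"
    by (simp add: exp_eq_polar rcis_cmod_Arg[unfolded rcis_def])
  also have "\<dots> = of_real (cmod (scaled n p) * exp (Re I)) * cis (angle n T p t)"
    by (simp add: angle_def cis_mult[symmetric] I_def x_def)
  finally have "scaled n (x t) = of_real (cmod (scaled n p) * exp (Re I)) * cis (angle n T p t)" .
  moreover have "cmod (scaled n p) * exp (Re I) > 0" using nz[of 0] sol(1) T by simp
  ultimately show ?thesis
    by (intro exI[of _ "cmod (scaled n p) * exp (Re I)"]) (auto simp: scaled_def complex_eq_iff)
qed

lemma angle_continuous_time: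
  assumes n: "0 < n" and E: "pot n a < energy n p" and T: "0 \<le> T"
  shows "continuous_on {0..T} (angle n T p)"
proof -
  note sol = flow[OF less_imp_le[OF n] T, of p]
  have "scaled n (flow n T p s) \<noteq> 0" if "s \<in> {0..T}" for s
    using scaled_nonzero[OF n] E energy_conserved[OF sol(2) that] sol(1) by simp
  then have "continuous_on {0..T} (\<lambda>s. scaled_velocity n (flow n T p s) / scaled n (flow n T p s))"
    by (intro continuous_intros autonomous_solution_continuous[OF sol(2)]) auto
  then show ?thesis
    unfolding angle_def
    by (intro continuous_on_add continuous_on_const continuous_on_Im indefinite_integral_continuous_1
        integrable_continuous_real)
qed

text \<open>The condition \<open>a < fst p\<close> keeps the initial point off the branch cut of
  \<open>Arg\<close>; the remaining term is an integral that depends continuously on its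
  parameter.\<close>

lemma angle_continuous_point:
  assumes n: "0 < n" and T: "0 \<le> T"
    and S: "\<And>p. p \<in> S \<Longrightarrow> pot n a < energy n p" "\<And>p. p \<in> S \<Longrightarrow> a < fst p"
  shows "continuous_on S (\<lambda>p. angle n T p T)"
proof -
  note nT = less_imp_le[OF n] T
  have nz: "scaled n (flow n T p s) \<noteq> 0" if "p \<in> S" "s \<in> {0..T}" for p s
    using scaled_nonzero[OF n] S(1)[OF that(1)] energy_conserved[OF flow(2)[OF nT] that(2), of p] flow(1)[OF nT]
    by simp
  have "continuous_on (S \<times> cbox 0 T) (\<lambda>(p, s). scaled_velocity n (flow n T p s) / scaled n (flow n T p s))"
    using continuous_on_flow[OF nT, of S] nz unfolding case_prod_beta
    by (intro continuous_intros) auto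
  from integral_continuous_on_param[OF this]
  have "continuous_on S (\<lambda>p. integral {0..T} (\<lambda>s. scaled_velocity n (flow n T p s) / scaled n (flow n T p s)))"
    by simp
  moreover have "continuous_on S (\<lambda>p. Arg (scaled n p))"
  proof -
    have "scaled n p \<notin> \<real>\<^sub>\<le>\<^sub>0" if "p \<in> S" for p
      using S(2)[OF that] by (auto simp: complex_nonpos_Reals_iff scaled_def)
    then show ?thesis by (intro continuous_intros) auto
  qed
  ultimately show ?thesis unfolding angle_def by (intro continuous_on_add continuous_on_Im)
qed

end

section \<open>The switched system\<close>

lemma second_quadrant:
  assumes "pi / 2 - 2 * pi * real i \<le> t" "t \<le> pi - 2 * pi * real i"
  shows "cos t \<le> 0" "0 \<le> sin t"
proof -
  define s where "s = t + 2 * real i * pi"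
  have s: "pi / 2 \<le> s" "s \<le> pi" using assms by (auto simp: s_def algebra_simps)
  have eq: "cos t = cos s" "sin t = sin s"
    by (simp_all add: s_def cos_add sin_add)
  have "0 \<le> sin (s - pi / 2)" using s pi_gt_zero by (intro sin_ge_zero) linarith+
  then show "cos t \<le> 0" by (simp add: eq sin_diff)
  show "0 \<le> sin t" unfolding eq using s pi_gt_zero by (intro sin_ge_zero) linarith+
qed

text \<open>
  The strong weight \<open>n\<close> acts for time \<open>\<alpha>\<close> and the weak weight \<open>m\<close> for time \<open>T\<close>. The inner energy level
  passes through \<open>(\<delta>, 0)\<close>, where \<open>\<delta>\<close> is so small that the weak flow does not carry this point beyond
  \<open>v = a\<close>.
\<close>

locale twist = nagumo +
  fixes \<alpha> T k \<delta> cm cp \<mu> n m :: real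
  assumes times: "0 < \<alpha>" "0 < T" and k: "0 \<le> k"
    and c: "a < cm" "cm < cp" "cp < 1"
    and \<delta>: "0 < \<delta>" "\<delta> * exp ((1 + k) * T) \<le> a" "prim cm < prim \<delta>"
    and \<mu>: "0 < \<mu>" "\<And>v. v \<in> {\<delta> / 2..cp} \<Longrightarrow> 2 * \<mu> \<le> max 0 (2 * (prim \<delta> - prim v)) + (v - a) * F v"
    and n: "0 < n" "(1 / T + k * T)\<^sup>2 / 2 + g < n * (prim \<delta> - prim cm)" "g < n * prim cp"
      "g < n * (prim (\<delta> / 2) - prim \<delta>)" "2 * g \<le> n * \<mu>" "g \<le> n"
      "4 * pi * (2 - 2 * prim a) < sqrt n * (\<alpha> * \<mu>)" "1 \<le> n * (2 * (prim \<delta> - prim a) * T\<^sup>2)"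
    and m: "0 \<le> m" "\<And>s. s \<in> {0..1} \<Longrightarrow> 0 \<le> g * s - m * F s \<and> g * s - m * F s \<le> k * s"
begin

text \<open>The heights are dictated by the weak phase. As the speed increases, getting from v <= a
  to v >= cm in time \<open>T\<close> needs a final speed of at least (cm - a)/T. Not passing v = 1
  needs an initial speed of at most 1/T, to which the force adds at most
  \<open>k * T\<close>.\<close>

definition y_min :: real where "y_min = (cm - a) / T"
definition y_max :: real where "y_max = 1 / T + k * T"
abbreviation rect :: "(real \<times> real) set" where "rect \<equiv> {cm..cp} \<times> {y_min..y_max}"

definition annulus :: "(real \<times> real) set" where
  "annulus = {p \<in> rect. pot n \<delta> \<le> energy n p \<and> energy n p \<le> 0}"

definition strong :: "real \<times> real \<Rightarrow> real \<times> real" where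
  "strong p = flow n \<alpha> p \<alpha>"

definition return :: "real \<times> real \<Rightarrow> real \<times> real" where
  "return p = flow m T (strong p) T"

definition turn :: "real \<times> real \<Rightarrow> real" where
  "turn p = angle n \<alpha> p \<alpha>"

lemma \<delta>_less: "\<delta> < a"
proof -
  have "0 < (1 + k) * T" using times k by (simp add: add_pos_nonneg)
  then have "\<delta> * 1 < \<delta> * exp ((1 + k) * T)" using \<delta>(1) by (intro mult_strict_left_mono) auto
  then show ?thesis using \<delta>(2) by simp
qed

lemma y_bounds: "0 < y_min" "y_min \<le> y_max"
proof -
  show "0 < y_min" using c times by (simp add: y_min_def)
  have "(cm - a) / T \<le> 1 / T" using c a times by (intro divide_right_mono) auto
  then show "y_min \<le> y_max" using k times by (simp add: y_min_def y_max_def add_increasing2)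
qed

lemma pot_\<delta>: "pot n \<delta> < 0" "pot n a < pot n \<delta>"
  using pot_decreasing[OF n(1), of 0 \<delta>] pot_decreasing[OF n(1), of \<delta> a] \<delta>_less \<delta>(1) pot_nonpos_arg[of 0] by auto

lemma g_half_sq: "v \<in> {0..1} \<Longrightarrow> 0 \<le> g * half_sq v \<and> g * half_sq v \<le> g"
  using half_sq_bounds[of v] mult_left_mono[of "half_sq v" 1 g] g by auto

lemma pot_cp: "0 < pot n cp"
  using n(3) g_half_sq[of cp] c a by (auto simp: pot_def)

text \<open>For large \<open>n\<close> the drop n (prim \<delta> - prim cm) outweighs the kinetic
  energy, at most y_max^2/2, and the bounded terms with \<open>g\<close>. So the left side lies
  inside the inner level, just as the right side lies outside the loop.\<close>

lemma energy_left: "y \<in> {y_min..y_max} \<Longrightarrow> energy n (cm, y) < pot n \<delta>"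
proof -
  assume "y \<in> {y_min..y_max}"
  then have "y\<^sup>2 \<le> y_max\<^sup>2" using y_bounds by (intro power_mono) auto
  moreover have "0 \<le> g * half_sq cm" "g * half_sq \<delta> \<le> g"
    using g_half_sq[of cm] g_half_sq[of \<delta>] c a \<delta>(1) \<delta>_less by auto
  moreover have "y_max\<^sup>2 / 2 + g < n * prim \<delta> - n * prim cm" using n(2) by (simp add: y_max_def algebra_simps)
  ultimately show ?thesis unfolding energy_def pot_def by simp
qed

lemma energy_right: "energy n (cp, y) > 0"
  using pot_cp zero_le_power2[of y] by (simp add: energy_def add_nonneg_pos)

lemma annulus_energy: "p \<in> annulus \<Longrightarrow> pot n a < energy n p"
  using pot_\<delta>(2) by (auto simp: annulus_def)

lemma annulus_fst: "p \<in> annulus \<Longrightarrow> a < fst p \<and> fst p < cp \<and> 0 < snd p"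
proof -
  assume p: "p \<in> annulus"
  then have "fst p \<noteq> cp" using energy_right[of "snd p"] by (auto simp: annulus_def)
  then show ?thesis using p c y_bounds by (auto simp: annulus_def)
qed

lemma annulus_trapped:
  assumes "p \<in> annulus" "t \<in> {0..\<alpha>}"
  shows "0 < fst (flow n \<alpha> p t)" "fst (flow n \<alpha> p t) < cp"
  using trapped[OF n(1) pot_cp _ _ _ assms(2)] annulus_fst[OF assms(1)] assms(1) a
  by (auto simp: annulus_def)

lemma annulus_flow_energy:
  assumes "t \<in> {0..\<alpha>}"
  shows "energy n (flow n \<alpha> p t) = energy n p"
  using energy_conserved[OF flow(2) assms] flow(1) n(1) times by simp

section \<open>The turning angle on the loop and on the inner level\<close>

lemma initial_angle:
  assumes "p \<in> annulus"
  shows "angle n \<alpha> p 0 \<in> {0<..<pi / 2}"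
proof -
  have "angle n \<alpha> p 0 = Arg (scaled n p)" by (simp add: angle_def)
  moreover have "0 < Re (scaled n p)" "0 < Im (scaled n p)"
    using annulus_fst[OF assms] n(1) by (auto simp: scaled_def)
  ultimately show ?thesis using Arg_lt_pi[of "scaled n p"] Arg_Re_pos[of "scaled n p"] by auto
qed

text \<open>
  Turning by \<open>- pi\<close> would require zero energy at a point of the axis \<open>y = 0\<close> with \<open>0 < v < a\<close>.
\<close>

lemma turn_homoclinic:
  assumes p: "p \<in> annulus" "energy n p = 0"
  shows "- pi < turn p"
proof (rule ccontr)
  assume "\<not> - pi < turn p"
  then obtain t where t: "0 \<le> t" "t \<le> \<alpha>" "angle n \<alpha> p t = - pi"
    using IVT2'[of "angle n \<alpha> p" \<alpha> "- pi" 0] initial_angle[OF p(1)] times pi_gt_zero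
      angle_continuous_time[OF n(1) annulus_energy[OF p(1)], of \<alpha>]
    by (auto simp: turn_def)
  then obtain r where r: "r > 0" "fst (flow n \<alpha> p t) - a = - r" "snd (flow n \<alpha> p t) = 0"
    using angle_polar[OF n(1) annulus_energy[OF p(1)], of t \<alpha>] n(1) by auto
  then have "pot n (fst (flow n \<alpha> p t)) = 0"
    using annulus_flow_energy[of t p] t p(2) by (simp add: energy_def)
  moreover have "pot n (fst (flow n \<alpha> p t)) < pot n 0"
    using annulus_trapped[OF p(1), of t] t r(1,2) by (intro pot_decreasing n) auto
  ultimately show False by (simp add: pot_nonpos_arg)
qed

text \<open>With w = y / sqrt n and \<epsilon> = g / n the angular velocity is -sqrt n (w^2 - (v -
  a)(\<epsilon> v - F v)) / ((v - a)^2 + w^2). On the inner level w^2 is 2 (prim \<delta> - prim v)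
  up to \<epsilon>, so for small \<epsilon> the numerator is at least \<mu>, and the denominator is
  at most 2 - 2 prim a.\<close>

lemma angular_velocity:
  assumes "0 < fst q" "fst q < cp" "energy n q = pot n \<delta>"
  shows "Im (scaled_velocity n q / scaled n q) \<le> - (sqrt n * (\<mu> / (2 - 2 * prim a)))"
proof -
  obtain v y where q: "q = (v, y)" by (cases q)
  define w where "w = y / sqrt n"
  have y: "y = sqrt n * w" using n(1) by (simp add: w_def)
  define \<epsilon> where "\<epsilon> = g / n"
  have \<epsilon>: "0 < \<epsilon>" "2 * \<epsilon> \<le> \<mu>" "\<epsilon> \<le> 1" "g = n * \<epsilon>" using g n(1,5,6) by (auto simp: \<epsilon>_def field_simps)
  have v: "0 < v" "v < cp" "v \<in> {0..1}" using assms(1,2) c by (auto simp: q)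
  have "(sqrt n * w)\<^sup>2 / 2 + (n * prim v - (n * \<epsilon>) * half_sq v) = n * prim \<delta> - (n * \<epsilon>) * half_sq \<delta>"
    using assms(3) unfolding energy_def pot_def q y fst_conv snd_conv \<epsilon>(4)[symmetric] .
  then have "n * (w\<^sup>2 / 2 + prim v - \<epsilon> * half_sq v) = n * (prim \<delta> - \<epsilon> * half_sq \<delta>)"
    using n(1) by (simp add: power_mult_distrib algebra_simps)
  then have "w\<^sup>2 / 2 + prim v - \<epsilon> * half_sq v = prim \<delta> - \<epsilon> * half_sq \<delta>"
    unfolding mult_cancel_left using n(1) by auto
  then have w2: "w\<^sup>2 = 2 * (prim \<delta> - prim v) + 2 * \<epsilon> * (half_sq v - half_sq \<delta>)"
    by (simp add: algebra_simps)
  have "0 \<le> half_sq v" "half_sq v \<le> 1 / 2" "0 \<le> half_sq \<delta>" "half_sq \<delta> \<le> 1 / 2"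
    using half_sq_bounds[OF v(3)] half_sq_bounds[of \<delta>] \<delta>(1) \<delta>_less a by auto
  then have "\<bar>half_sq v - half_sq \<delta>\<bar> \<le> 1 / 2" unfolding abs_le_iff by linarith
  then have "\<bar>2 * \<epsilon> * (half_sq v - half_sq \<delta>)\<bar> \<le> \<epsilon>"
    using \<epsilon>(1) mult_left_mono[of "\<bar>half_sq v - half_sq \<delta>\<bar>" "1 / 2" "2 * \<epsilon>"] by (simp add: abs_mult)
  then have w2_bounds: "2 * (prim \<delta> - prim v) - \<epsilon> \<le> w\<^sup>2" "w\<^sup>2 \<le> 2 * (prim \<delta> - prim v) + \<epsilon>"
    using w2 by linarith+
  have "prim \<delta> + \<epsilon> < prim (\<delta> / 2)" using n(1,4) by (simp add: \<epsilon>_def field_simps)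
  \<comment> \<open>Left of \<delta>/2 the primitive exceeds \<open>prim \<delta>\<close> by more
    than \<epsilon>, which would make w^2 negative. The bound brings v into the range where \<mu> is
    available.\<close>
  have "\<delta> / 2 \<le> v"
  proof (rule ccontr)
    assume "\<not> \<delta> / 2 \<le> v"
    then have "prim (\<delta> / 2) < prim v" using v \<delta>_less \<delta>(1) by (intro prim_decreasing) auto
    then have "prim \<delta> + \<epsilon> < prim v" using \<open>prim \<delta> + \<epsilon> < prim (\<delta> / 2)\<close> by (rule less_trans[rotated])
    then show False using w2_bounds(2) \<epsilon>(1) zero_le_power2[of w] by (simp add: algebra_simps)
  qed
  then have *: "2 * \<mu> \<le> max 0 (2 * (prim \<delta> - prim v)) + (v - a) * F v" using v by (intro \<mu>(2)) auto
  have "(v - a) * v \<le> 1" using mult_mono[of "v - a" 1 v 1] v a by auto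
  then have "\<epsilon> * ((v - a) * v) \<le> \<epsilon>" using \<epsilon>(1) by (intro mult_left_le) auto
  \<comment> \<open>The quantity w^2 + \<epsilon> dominates both entries of the maximum. This and
    the term \<epsilon> (v - a) v cost \<epsilon> each, together at most \<mu>, so \<mu> is left of
    the 2 \<mu>.\<close>
  then have num: "\<mu> \<le> w\<^sup>2 - (v - a) * (\<epsilon> * v - F v)"
  proof -
    have "0 \<le> w\<^sup>2 + \<epsilon>" using \<epsilon>(1) by (simp add: add_nonneg_pos less_imp_le)
    then have "max 0 (2 * (prim \<delta> - prim v)) \<le> w\<^sup>2 + \<epsilon>" using w2_bounds(1) by auto
    moreover have "(v - a) * (\<epsilon> * v - F v) = \<epsilon> * ((v - a) * v) - (v - a) * F v" by (simp add: algebra_simps)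
    ultimately show ?thesis using * \<epsilon>(2) \<open>\<epsilon> * ((v - a) * v) \<le> \<epsilon>\<close> by linarith
  qed
  have "prim \<delta> < 0" using prim_decreasing[of 0 \<delta>] \<delta>_less \<delta>(1) prim(1) by auto
  moreover have "(v - a)\<^sup>2 \<le> 1" using v a by (simp add: abs_square_le_1)
  \<comment> \<open>Since prim \<delta> < 0 and \<epsilon> <= 1, w^2 is at most 1 - 2 prim
    a.\<close>
  ultimately have den: "(v - a)\<^sup>2 + w\<^sup>2 \<le> 2 - 2 * prim a"
    using w2_bounds(2) \<epsilon>(3) prim_ge[OF v(3)] by (simp add: algebra_simps)
  have "0 < (v - a)\<^sup>2 + w\<^sup>2"
  proof -
    have "scaled n q \<noteq> 0" using scaled_nonzero[OF n(1)] assms(3) pot_\<delta>(2) by simp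
    then show ?thesis by (auto simp: q scaled_def complex_eq_iff w_def sum_power2_gt_zero_iff)
  qed
  then have "\<mu> / (2 - 2 * prim a) \<le> (w\<^sup>2 - (v - a) * (\<epsilon> * v - F v)) / ((v - a)\<^sup>2 + w\<^sup>2)"
    using num den \<mu>(1) by (intro frac_le) auto
  then have le: "sqrt n * (\<mu> / (2 - 2 * prim a)) \<le> sqrt n * ((w\<^sup>2 - (v - a) * (\<epsilon> * v - F v)) / ((v - a)\<^sup>2 + w\<^sup>2))"
    using n(1) by (intro mult_left_mono) auto
  have "force n v / sqrt n = sqrt n * (\<epsilon> * v - F v)"
    using n(1) v(3) by (simp add: force_def unit_clamp(4) \<epsilon>_def field_simps)
  then have "Im (scaled_velocity n q / scaled n q) =
     (sqrt n * (\<epsilon> * v - F v) * (v - a) - sqrt n * w * w) / ((v - a)\<^sup>2 + w\<^sup>2)"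
    by (simp add: Im_divide scaled_velocity_def scaled_def q y n(1))
  also have "\<dots> = - (sqrt n * ((w\<^sup>2 - (v - a) * (\<epsilon> * v - F v)) / ((v - a)\<^sup>2 + w\<^sup>2)))"
    by (simp add: power2_eq_square minus_divide_left algebra_simps)
  finally show ?thesis using le by linarith
qed

text \<open>The orbit starts below the angle pi/2 and loses more than 4 pi during the strong
  phase.\<close>

lemma turn_inner:
  assumes p: "p \<in> annulus" "energy n p = pot n \<delta>"
  shows "turn p < - (7 / 2) * pi"
proof -
  let ?h = "\<lambda>s. scaled_velocity n (flow n \<alpha> p s) / scaled n (flow n \<alpha> p s)"
  let ?K = "sqrt n * (\<mu> / (2 - 2 * prim a))"
  have n\<alpha>: "0 \<le> n" "0 \<le> \<alpha>" using n(1) times by auto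
  note sol = flow[OF n\<alpha>, of p]
  have "scaled n (flow n \<alpha> p s) \<noteq> 0" if "s \<in> {0..\<alpha>}" for s
    using scaled_nonzero[OF n(1)] annulus_flow_energy[OF that] annulus_energy[OF p(1)] by simp
  then have "continuous_on {0..\<alpha>} ?h"
    by (intro continuous_intros autonomous_solution_continuous[OF sol(2)]) auto
  then have I: "(?h has_integral integral {0..\<alpha>} ?h) {0..\<alpha>}"
    by (intro integrable_integral integrable_continuous_real)
  have "Im (integral {0..\<alpha>} ?h) \<le> - ?K * \<alpha>"
  proof (rule has_integral_le)
    show "((\<lambda>s. Im (?h s)) has_integral Im (integral {0..\<alpha>} ?h)) {0..\<alpha>}" by (rule has_integral_Im[OF I])
    show "((\<lambda>_. - ?K) has_integral - ?K * \<alpha>) {0..\<alpha>}"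
      using has_integral_const_real[of "- ?K" 0 \<alpha>] n\<alpha> by (simp add: mult.commute)
    show "Im (?h s) \<le> - ?K" if "s \<in> {0..\<alpha>}" for s
      using angular_velocity annulus_trapped[OF p(1) that] annulus_flow_energy[OF that] p(2) by simp
  qed
  moreover have "4 * pi < ?K * \<alpha>"
  proof -
    have "0 < 2 - 2 * prim a" using prim_decreasing[of 0 a] prim(1) a by auto
    then show ?thesis using n(7) by (simp add: field_simps)
  qed
  moreover have "turn p = angle n \<alpha> p 0 + Im (integral {0..\<alpha>} ?h)" by (simp add: turn_def angle_def)
  ultimately show ?thesis using initial_angle[OF p(1)] by auto
qed

section \<open>The weak phase after i turns\<close>

lemma turn_polar:
  assumes "p \<in> annulus"
  obtains r where "r > 0" "fst (strong p) - a = r * cos (turn p)" "snd (strong p) / sqrt n = r * sin (turn p)"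
  using angle_polar[OF n(1) annulus_energy[OF assms], of \<alpha> \<alpha>] times by (auto simp: strong_def turn_def)

lemma strong_facts:
  assumes "p \<in> annulus"
  shows "0 < fst (strong p)" "energy n (strong p) = energy n p"
  using annulus_trapped[OF assms, of \<alpha>] annulus_flow_energy[of \<alpha> p] times by (auto simp: strong_def)

lemma strong_quadrant:
  assumes "p \<in> annulus" "pi / 2 - 2 * pi * real i \<le> turn p" "turn p \<le> pi - 2 * pi * real i"
  shows "fst (strong p) \<le> a" "0 \<le> snd (strong p)"
proof -
  obtain r where r: "r > 0" "fst (strong p) - a = r * cos (turn p)" "snd (strong p) / sqrt n = r * sin (turn p)"
    using turn_polar[OF assms(1)] .
  have "r * cos (turn p) \<le> 0" using second_quadrant(1)[OF assms(2,3)] r(1) by (intro mult_nonneg_nonpos) auto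
  then show "fst (strong p) \<le> a" using r(2) by linarith
  have "0 \<le> snd (strong p) / sqrt n" using second_quadrant(2)[OF assms(2,3)] r(1,3) by simp
  then show "0 \<le> snd (strong p)" using n(1) by (simp add: zero_le_divide_iff)
qed

lemmas weak_push = push[OF flow(2)[OF m(1) less_imp_le[OF times(2)]] less_imp_le[OF times(2)] k m(2),
    unfolded flow(1)[OF m(1) less_imp_le[OF times(2)]]]

text \<open>At this end of the window the point is at rest left of v = a. Its energy is at least
  that of the inner level and the potential decreases on [0,a], so v <= \<delta>; then \<delta> was
  chosen so that the weak flow does not get past a.\<close>

lemma return_at_upper:
  assumes "p \<in> annulus" "turn p = pi - 2 * pi * real i"
  shows "fst (return p) \<le> a"
proof -
  obtain r where r: "r > 0" "fst (strong p) - a = r * cos (turn p)" "snd (strong p) / sqrt n = r * sin (turn p)"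
    using turn_polar[OF assms(1)] .
  have "cos (2 * pi * real i) = 1" "sin (2 * pi * real i) = 0"
    using cos_2npi[of i] sin_2npi[of i] by (simp_all add: mult_ac)
  then have "cos (turn p) = - 1" "sin (turn p) = 0" by (simp_all add: assms(2) cos_diff sin_diff)
  then have q: "snd (strong p) = 0" "fst (strong p) < a" using r n(1) by auto
  have "pot n \<delta> \<le> pot n (fst (strong p))"
    using strong_facts(2)[OF assms(1)] assms(1) q by (simp add: energy_def annulus_def)
  then have "fst (strong p) \<le> \<delta>"
    using pot_decreasing[OF n(1), of \<delta> "fst (strong p)"] q \<delta>(1) by force
  then have "fst (strong p) * exp ((1 + k) * T) \<le> \<delta> * exp ((1 + k) * T)" by (intro mult_right_mono) auto
  moreover have "fst (return p) \<le> fst (strong p) * exp ((1 + k) * T)"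
    unfolding return_def using weak_push(6)[of "strong p"] strong_facts(1)[OF assms(1)] q by auto
  ultimately show ?thesis using \<delta>(2) by linarith
qed

text \<open>At this end the point is on v = a with y > 0. Its energy forces a speed of at least 1/T,
  and keeping that speed for time \<open>T\<close> already covers the distance 1.\<close>

lemma return_at_lower:
  assumes "p \<in> annulus" "turn p = pi / 2 - 2 * pi * real i"
  shows "1 \<le> fst (return p)"
proof -
  obtain r where r: "r > 0" "fst (strong p) - a = r * cos (turn p)" "snd (strong p) / sqrt n = r * sin (turn p)"
    using turn_polar[OF assms(1)] .
  have "cos (2 * pi * real i) = 1" "sin (2 * pi * real i) = 0"
    using cos_2npi[of i] sin_2npi[of i] by (simp_all add: mult_ac)
  then have "cos (turn p) = 0" "sin (turn p) = 1" by (simp_all add: assms(2) cos_diff sin_diff)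
  then have q: "fst (strong p) = a" "0 < snd (strong p)" using r n(1) by (auto simp: zero_less_divide_iff)
  have "pot n \<delta> \<le> (snd (strong p))\<^sup>2 / 2 + pot n a"
    using strong_facts(2)[OF assms(1)] assms(1) q by (simp add: energy_def annulus_def)
  moreover have "g * half_sq \<delta> \<le> g * half_sq a" using half_sq_mono[of \<delta> a] \<delta>_less g by simp
  ultimately have "n * (2 * (prim \<delta> - prim a)) \<le> (snd (strong p))\<^sup>2" by (simp add: pot_def algebra_simps)
  then have "n * (2 * (prim \<delta> - prim a)) * T\<^sup>2 \<le> (snd (strong p))\<^sup>2 * T\<^sup>2" by (intro mult_right_mono) auto
  then have "1\<^sup>2 \<le> (snd (strong p) * T)\<^sup>2" using n(8) by (simp add: power_mult_distrib algebra_simps)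
  then have "1 \<le> snd (strong p) * T" by (rule power2_le_imp_le) (use q times in auto)
  moreover have "fst (strong p) + snd (strong p) * T \<le> fst (return p)"
    unfolding return_def using weak_push(3)[of "strong p"] q a by auto
  ultimately show ?thesis using q a by linarith
qed

lemma return_landing:
  assumes p: "p \<in> annulus" "pi / 2 - 2 * pi * real i \<le> turn p" "turn p \<le> pi - 2 * pi * real i"
    and r: "cm \<le> fst (return p)" "fst (return p) \<le> cp"
  shows "snd (return p) \<in> {y_min..y_max}"
    and "\<And>t. t \<in> {0..T} \<Longrightarrow> fst (flow m T (strong p) t) \<in> {0..1}"
proof -
  note q = strong_facts(1)[OF p(1)] strong_quadrant[OF p]
  note P = weak_push[of "strong p", folded return_def]
  have "cm \<le> a + snd (return p) * T" using P(4) q r by auto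
  then have 1: "y_min \<le> snd (return p)" using times by (simp add: y_min_def field_simps)
  have "snd (strong p) * T \<le> 1" using P(3) q r c by auto
  then have "snd (strong p) \<le> 1 / T" using times by (simp add: field_simps)
  then have "snd (return p) \<le> y_max" using P(2) q by (auto simp: y_max_def)
  with 1 show "snd (return p) \<in> {y_min..y_max}" by auto
  show "fst (flow m T (strong p) t) \<in> {0..1}" if "t \<in> {0..T}" for t
    using P(5)[OF _ _ _ that] q r c by auto
qed

section \<open>Itinerary sets and the extended return map\<close>

definition itinerary_set :: "nat \<Rightarrow> (real \<times> real) set" where
  "itinerary_set i = {p \<in> annulus. pi / 2 - 2 * pi * real i \<le> turn p \<and> turn p \<le> pi - 2 * pi * real i \<and>
     cm \<le> fst (return p) \<and> fst (return p) \<le> cp}"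

text \<open>
  The first coordinate of the return map after \<open>i\<close> turns, cut off to \<open>[a, 1]\<close> and extended by the
  constants that it attains where the turning angle enters and leaves its window.
\<close>

definition stretch :: "nat \<Rightarrow> real \<times> real \<Rightarrow> real" where
  "stretch i p = (if energy n p \<le> pot n \<delta> then 1 else if 0 \<le> energy n p then a
     else if pi - 2 * pi * real i \<le> turn p then a else if turn p \<le> pi / 2 - 2 * pi * real i then 1
     else max a (min 1 (fst (return p))))"

lemma compact_annulus: "compact annulus"
proof -
  have "annulus = rect \<inter> {p. pot n \<delta> \<le> energy n p} \<inter> {p. energy n p \<le> 0}" by (auto simp: annulus_def)
  moreover have "closed {p. pot n \<delta> \<le> energy n p}" "closed {p. energy n p \<le> 0}"
    by (intro closed_Collect_le continuous_on_energy continuous_on_const)+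
  moreover have "compact rect" by (intro compact_Times) auto
  ultimately show ?thesis by (simp add: compact_Int_closed)
qed

lemma continuous_on_return: "continuous_on S return"
proof -
  have "continuous_on S strong" unfolding strong_def
    by (rule flow_end_continuous) (use n times in auto)
  then show ?thesis unfolding return_def
    by (rule continuous_on_compose2[OF flow_end_continuous[OF m(1) less_imp_le[OF times(2)], of UNIV]]) auto
qed

lemma continuous_on_turn: "continuous_on annulus turn"
  unfolding turn_def using annulus_energy annulus_fst n times
  by (intro angle_continuous_point) auto

lemma inj_return: "inj return"
proof (rule injI)
  fix p q assume "return p = return q"
  then have "strong p = strong q"
    unfolding return_def using flow_inj[of m T T] m times by auto
  then show "p = q" unfolding strong_def using flow_inj[of n \<alpha> \<alpha>] n times by auto
qed

lemma closed_annulus_parts: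
  "closed {p \<in> annulus. u \<le> turn p}" "closed {p \<in> annulus. turn p \<le> u}"
proof -
  have "closed (annulus \<inter> turn -` {u..})" "closed (annulus \<inter> turn -` {..u})"
    by (intro continuous_closed_preimage continuous_on_turn compact_imp_closed compact_annulus closed_atLeast closed_atMost)+
  then show "closed {p \<in> annulus. u \<le> turn p}" "closed {p \<in> annulus. turn p \<le> u}"
    by (simp_all add: Int_def vimage_def conj_commute)
qed

lemma compact_itinerary_set: "compact (itinerary_set i)"
proof -
  have "itinerary_set i = annulus \<inter> {p \<in> annulus. pi / 2 - 2 * pi * real i \<le> turn p} \<inter>
      {p \<in> annulus. turn p \<le> pi - 2 * pi * real i} \<inter> {p. cm \<le> fst (return p)} \<inter> {p. fst (return p) \<le> cp}"
    by (auto simp: itinerary_set_def)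
  moreover have "closed {p. cm \<le> fst (return p)}" "closed {p. fst (return p) \<le> cp}"
    by (intro closed_Collect_le continuous_intros continuous_on_return)+
  ultimately show ?thesis
    using compact_annulus closed_annulus_parts by (simp add: compact_Int_closed)
qed

text \<open>Five closed pieces cover the rectangle, and the prescriptions agree where they overlap.
  On the inner level the angle is already past the window, with value 1, and on the loop it has not
  entered it, with value \<open>a\<close>. At the ends of the window the cut-off return map equals
  these constants by \<open>return_at_upper\<close> and \<open>return_at_lower\<close>.\<close>

lemma continuous_on_stretch:
  assumes "i \<in> {1, 2}"
  shows "continuous_on rect (stretch i)"
proof -
  define u l where "u = pi - 2 * pi * real i" and "l = pi / 2 - 2 * pi * real i"
  have lu: "l < u" "- (7 / 2) * pi \<le> l" "u \<le> - pi"
    using assms pi_gt_zero by (auto simp: u_def l_def algebra_simps)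
  let ?I = "{p \<in> rect. energy n p \<le> pot n \<delta>}" and ?O = "{p \<in> rect. 0 \<le> energy n p}"
  let ?A = "{p \<in> annulus. u \<le> turn p}" and ?B = "{p \<in> annulus. turn p \<le> l}"
  let ?C = "{p \<in> annulus. l \<le> turn p} \<inter> {p \<in> annulus. turn p \<le> u}"
  have on_inner: "turn p < l" if "p \<in> annulus" "energy n p = pot n \<delta>" for p
    using turn_inner[OF that] lu by linarith
  have on_outer: "u < turn p" if "p \<in> annulus" "energy n p = 0" for p
    using turn_homoclinic[OF that] lu by linarith
  have E: "\<not> energy n p \<le> pot n \<delta>" if "0 \<le> energy n p" for p using that pot_\<delta>(1) by linarith
  have ann: "pot n \<delta> \<le> energy n p" "energy n p \<le> 0" if "p \<in> annulus" for p using that by (auto simp: annulus_def)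
  have cl: "closed ?I" "closed ?O" "closed ?A" "closed ?B" "closed ?C"
  proof -
    have r: "closed rect" by (intro closed_Times) auto
    have "?I = rect \<inter> {p. energy n p \<le> pot n \<delta>}" "?O = rect \<inter> {p. 0 \<le> energy n p}" by auto
    then show "closed ?I" "closed ?O" using r
      by (auto intro!: closed_Int closed_Collect_le continuous_on_energy continuous_on_const)
  qed (auto intro: closed_annulus_parts)
  have cont: "continuous_on ?I (stretch i)" "continuous_on ?O (stretch i)" "continuous_on ?A (stretch i)"
    "continuous_on ?B (stretch i)" "continuous_on ?C (stretch i)"
  proof -
    have "stretch i p = 1" if "p \<in> ?I" for p using that by (auto simp: stretch_def)
    then show "continuous_on ?I (stretch i)" using continuous_on_cong[of ?I ?I "stretch i" "\<lambda>_. 1"] by auto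
    have "stretch i p = a" if "p \<in> ?O" for p using that E by (auto simp: stretch_def)
    then show "continuous_on ?O (stretch i)" using continuous_on_cong[of ?O ?O "stretch i" "\<lambda>_. a"] by auto
    have "stretch i p = a" if "p \<in> ?A" for p
      using that on_inner[of p] ann[of p] lu E by (auto simp: stretch_def u_def)
    then show "continuous_on ?A (stretch i)" using continuous_on_cong[of ?A ?A "stretch i" "\<lambda>_. a"] by auto
    have "stretch i p = 1" if "p \<in> ?B" for p
      using that on_outer[of p] ann[of p] lu E unfolding stretch_def u_def[symmetric] l_def[symmetric] by auto
    then show "continuous_on ?B (stretch i)" using continuous_on_cong[of ?B ?B "stretch i" "\<lambda>_. 1"] by auto
    have "stretch i p = max a (min 1 (fst (return p)))" if p: "p \<in> ?C" for p
    proof -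
      have "\<not> energy n p \<le> pot n \<delta>" "\<not> 0 \<le> energy n p"
        using p on_inner[of p] on_outer[of p] ann[of p] by auto
      moreover have "turn p = u \<Longrightarrow> fst (return p) \<le> a" "turn p = l \<Longrightarrow> 1 \<le> fst (return p)"
        using return_at_upper[of p i] return_at_lower[of p i] p by (auto simp: u_def l_def)
      ultimately show ?thesis using p a unfolding stretch_def u_def[symmetric] l_def[symmetric]
        by auto
    qed
    then show "continuous_on ?C (stretch i)"
      using continuous_on_cong[of ?C ?C "stretch i" "\<lambda>p. max a (min 1 (fst (return p)))"]
      by (auto intro!: continuous_intros continuous_on_return)
  qed
  have "rect = ?I \<union> (?O \<union> (?A \<union> (?B \<union> ?C)))"
    by (auto simp: annulus_def)
  moreover have "continuous_on (?I \<union> (?O \<union> (?A \<union> (?B \<union> ?C)))) (stretch i)"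
    by (intro continuous_on_closed_Un cont cl closed_Un)
  ultimately show ?thesis by simp
qed

text \<open>The left side gets the value 1 and the right side the value \<open>a\<close>, both
  outside [cm, cp]. Hence an image in the rectangle can only come from the true return map, and
  there \<open>return_landing\<close> makes the clamp of the second coordinate inactive.\<close>

lemma stretch_crossing:
  assumes i: "i \<in> {1, 2}"
  defines "M \<equiv> \<lambda>p. (stretch i p, max y_min (min y_max (snd (return p))))"
  shows "crossing cm cp y_min y_max M"
    and "p \<in> rect \<Longrightarrow> M p \<in> rect \<Longrightarrow> p \<in> itinerary_set i \<and> M p = return p"
proof -
  have "continuous_on rect M"
    unfolding M_def by (intro continuous_intros continuous_on_stretch[OF i] continuous_on_return)
  moreover have "snd (M p) \<in> {y_min..y_max}" for p using y_bounds by (auto simp: M_def)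
  moreover have "fst (M (cm, y)) = 1" "fst (M (cp, y)) = a" if "y \<in> {y_min..y_max}" for y
    using energy_left[OF that] energy_right[of y] pot_\<delta>(1) by (auto simp: M_def stretch_def)
  ultimately show "crossing cm cp y_min y_max M" using c unfolding crossing_def by auto
  assume p: "p \<in> rect" "M p \<in> rect"
  then have s: "cm \<le> stretch i p" "stretch i p \<le> cp" by (auto simp: M_def)
  then have *: "\<not> energy n p \<le> pot n \<delta>" "\<not> 0 \<le> energy n p" "\<not> pi - 2 * pi * real i \<le> turn p"
    "\<not> turn p \<le> pi / 2 - 2 * pi * real i"
    using c by (auto simp: stretch_def split: if_splits)
  then have st: "stretch i p = max a (min 1 (fst (return p)))" by (simp add: stretch_def)
  then have r: "stretch i p = fst (return p)" using s c by (auto simp: max_def min_def split: if_splits)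
  have ann: "p \<in> annulus" using p(1) * by (auto simp: annulus_def)
  then have "p \<in> itinerary_set i" using * s r by (auto simp: itinerary_set_def)
  moreover have "snd (return p) \<in> {y_min..y_max}"
    using return_landing(1)[OF ann, of i] * s r by auto
  ultimately show "p \<in> itinerary_set i \<and> M p = return p" using r by (auto simp: M_def prod_eq_iff)
qed

lemma itinerary_sets_disjoint: "itinerary_set 1 \<inter> itinerary_set 2 = {}"
proof -
  have "\<not> (pi / 2 - 2 * pi * real 1 \<le> t \<and> t \<le> pi - 2 * pi * real 2)" for t
    using pi_gt_zero by (simp only: of_nat_1 of_nat_numeral) linarith
  then show ?thesis unfolding itinerary_set_def by blast
qed

lemma poincare_map_return:
  assumes C1: "F C1_differentiable_on UNIV" and z: "z \<in> itinerary_set i"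
    and X: "X = planar_field g (stepwise_weight \<alpha> (\<alpha> + T) m n) F"
  shows "z \<in> poincare_dom X (\<alpha> + T)" "poincare_map X (\<alpha> + T) z = return z"
proof -
  have z': "z \<in> annulus" "pi / 2 - 2 * pi * real i \<le> turn z" "turn z \<le> pi - 2 * pi * real i"
    "cm \<le> fst (return z)" "fst (return z) \<le> cp" using z by (auto simp: itinerary_set_def)
  have cont: "continuous_on UNIV (nagumo_field g F b)" for b
    unfolding nagumo_field_def case_prod_beta by (intro continuous_intros)
  have step: "solves_ivp_on X (\<alpha> + T) z \<zeta> \<longleftrightarrow> \<zeta> 0 = z \<and> autonomous_solution (nagumo_field g F n) 0 \<alpha> \<zeta> \<and>
      autonomous_solution (nagumo_field g F m) \<alpha> (\<alpha> + T) \<zeta>" for \<zeta>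
    by (rule solves_ivp_on_stepwise[OF _ _ cont cont])
      (use times in \<open>auto simp: X planar_field_def stepwise_weight_def nagumo_field_def\<close>)
  have same: "autonomous_solution (nagumo_field g F b) r s x \<longleftrightarrow> autonomous_solution (field b) r s x"
    if "\<And>t. t \<in> {r..s} \<Longrightarrow> fst (x t) \<in> {0..1}" for b r s x
    using that by (intro autonomous_solution_cong)
      (simp add: nagumo_field_def field_def force_def unit_clamp(4) case_prod_beta)
  define \<zeta> where "\<zeta> t = (if t \<le> \<alpha> then flow n \<alpha> z t else flow m T (strong z) (t - \<alpha>))" for t
  have \<zeta>2: "\<zeta> (t + \<alpha>) = flow m T (strong z) t" if "t \<in> {0..T}" for t
    using that flow(1)[of m T "strong z"] m(1) times by (auto simp: \<zeta>_def strong_def)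
  have "autonomous_solution (field n) 0 \<alpha> \<zeta>"
    by (rule autonomous_solution_transform[OF flow(2)[of n \<alpha> z]]) (use n times in \<open>auto simp: \<zeta>_def\<close>)
  moreover have "fst (\<zeta> t) \<in> {0..1}" if "t \<in> {0..\<alpha>}" for t
    using annulus_trapped[OF z'(1) that] that c by (auto simp: \<zeta>_def)
  ultimately have 1: "autonomous_solution (nagumo_field g F n) 0 \<alpha> \<zeta>"
    by (subst same)
  have "autonomous_solution (field m) 0 T (\<lambda>t. \<zeta> (t + \<alpha>))"
    by (rule autonomous_solution_transform[OF flow(2)[of m T "strong z"]]) (use m(1) times \<zeta>2 in auto)
  then have "autonomous_solution (field m) (0 + \<alpha>) (T + \<alpha>) \<zeta>"
    unfolding autonomous_solution_shift .
  moreover have "fst (\<zeta> t) \<in> {0..1}" if "t \<in> {\<alpha>..\<alpha> + T}" for t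
    using return_landing(2)[OF z', of "t - \<alpha>"] \<zeta>2[of "t - \<alpha>"] that by auto
  ultimately have 2: "autonomous_solution (nagumo_field g F m) \<alpha> (\<alpha> + T) \<zeta>"
    by (subst same) (auto simp: add.commute)
  have "\<zeta> 0 = z" using flow(1)[of n \<alpha> z] n times by (simp add: \<zeta>_def)
  with 1 2 have sol: "solves_ivp_on X (\<alpha> + T) z \<zeta>" by (simp add: step)
  then show "z \<in> poincare_dom X (\<alpha> + T)" by (auto simp: poincare_dom_def)
  have final: "\<zeta> (\<alpha> + T) = return z" using \<zeta>2[of T] times by (simp add: return_def add.commute)
  show "poincare_map X (\<alpha> + T) z = return z"
    unfolding poincare_map_def
  proof (rule the_equality)
    show "\<exists>\<zeta>. solves_ivp_on X (\<alpha> + T) z \<zeta> \<and> \<zeta> (\<alpha> + T) = return z" using sol final by blast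
    fix w assume "\<exists>\<zeta>. solves_ivp_on X (\<alpha> + T) z \<zeta> \<and> \<zeta> (\<alpha> + T) = w"
    then obtain \<eta> where \<eta>: "solves_ivp_on X (\<alpha> + T) z \<eta>" "\<eta> (\<alpha> + T) = w" by blast
    note s = sol[unfolded step] \<eta>(1)[unfolded step]
    note lip = nagumo_field_locally_lipschitz[OF C1]
    have eq: "\<zeta> \<alpha> = \<eta> \<alpha>"
      by (rule autonomous_solution_unique[of "nagumo_field g F n" 0 \<alpha>, OF _ _ _ lip]) (use s times in auto)
    have "\<zeta> (\<alpha> + T) = \<eta> (\<alpha> + T)"
      by (rule autonomous_solution_unique[of "nagumo_field g F m" \<alpha> "\<alpha> + T" \<zeta> \<eta>, OF _ _ eq lip]) (use s times in auto)
    then show "w = return z" using final \<eta>(2) by simp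
  qed
qed

lemma twist_horseshoe:
  assumes C1: "F C1_differentiable_on UNIV"
    and X: "X = planar_field g (stepwise_weight \<alpha> (\<alpha> + T) m n) F"
  defines "\<psi> \<equiv> poincare_map X (\<alpha> + T)"
  shows "\<exists>\<Lambda> h. compact \<Lambda> \<and> \<Lambda> \<subseteq> {a<..<1} \<times> {0<..} \<and>
          \<Lambda> \<subseteq> poincare_dom X (\<alpha> + T) \<and> \<psi> ` \<Lambda> = \<Lambda> \<and>
          semiconjugate_via \<Lambda> \<psi> h two_symbol_seqs bernoulli_shift \<and>
          (\<forall>i\<in>two_symbol_seqs. periodic_seq i \<longrightarrow>
             (\<exists>z\<in>\<Lambda>. periodic_point \<psi> z \<and> h z = i))"
proof -
  let ?H = "itinerary_set 1 \<union> itinerary_set 2"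
  have \<psi>: "\<psi> z = return z" "z \<in> poincare_dom X (\<alpha> + T)" if "z \<in> ?H" for z
  proof -
    obtain i where "z \<in> itinerary_set i" using \<open>z \<in> ?H\<close> by blast
    from poincare_map_return[OF C1 this X] show "\<psi> z = return z" "z \<in> poincare_dom X (\<alpha> + T)"
      by (simp_all add: \<psi>_def)
  qed
  let ?M = "\<lambda>i z. (stretch i z, max y_min (min y_max (snd (return z))))"
  have cont: "continuous_on ?H \<psi>"
    using continuous_on_cong[of ?H ?H \<psi> return] \<psi>(1) continuous_on_return[of ?H] by simp
  have inj: "inj_on \<psi> ?H"
    using inj_return \<psi>(1) unfolding inj_on_def by auto
  have maps: "z \<in> itinerary_set i \<and> ?M i z = \<psi> z" if "i \<in> {1, 2}" "z \<in> rect" "?M i z \<in> rect" for i z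
    using stretch_crossing(2)[OF that] \<psi>(1)[of z] that(1) by auto
  obtain \<Lambda> h where \<Lambda>: "compact \<Lambda>" "\<Lambda> \<subseteq> ?H" "\<psi> ` \<Lambda> = \<Lambda>"
    "semiconjugate_via \<Lambda> \<psi> h two_symbol_seqs bernoulli_shift"
    "\<And>s. s \<in> two_symbol_seqs \<Longrightarrow> periodic_seq s \<Longrightarrow> \<exists>z\<in>\<Lambda>. periodic_point \<psi> z \<and> h z = s"
    by (rule crossing_horseshoe[of cm cp y_min y_max itinerary_set \<psi> ?M, OF less_imp_le[OF c(2)]
        y_bounds(2) compact_itinerary_set itinerary_sets_disjoint cont inj stretch_crossing(1) maps]) blast+
  have "itinerary_set i \<subseteq> {a<..<1} \<times> {0<..}" for i
    using annulus_fst c by (force simp: itinerary_set_def)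
  then have "\<Lambda> \<subseteq> {a<..<1} \<times> {0<..}" using \<Lambda>(2) by blast
  moreover have "\<Lambda> \<subseteq> poincare_dom X (\<alpha> + T)" using \<Lambda>(2) \<psi>(2) by blast
  ultimately show ?thesis
    by (intro exI[of _ \<Lambda>] exI[of _ h] conjI ballI impI) (rule \<Lambda> | assumption)+
qed

end

section \<open>Choice of the constants, uniformly in the weak weight\<close>

lemma eventually_less_mult:
  fixes A c :: real
  assumes "0 < c"
  shows "\<forall>\<^sub>F n in at_top. A < n * c"
  using eventually_gt_at_top[of "A / c"] by eventually_elim (use assms in \<open>simp add: field_simps\<close>)

theorem theorem1p1:
  fixes g a \<alpha> \<beta> :: real and F :: "real \<Rightarrow> real"
  assumes "g > 0"
    and "F C1_differentiable_on UNIV"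
    and "0 < a" and "a < 1"
    and "F 0 = 0" and "F a = 0" and "F 1 = 0"
    and "\<And>s. 0 < s \<Longrightarrow> s < a \<Longrightarrow> F s < 0"
    and "\<And>s. s > 1 \<Longrightarrow> F s < 0"
    and "\<And>s. s < 0 \<Longrightarrow> F s > 0"
    and "\<And>s. a < s \<Longrightarrow> s < 1 \<Longrightarrow> F s > 0"
    and "strictly_convex_on {0..a} F"
    and "strictly_concave_on {a..1} F"
    and "integral {0..1} F > 0"
    and "0 < \<alpha>" and "\<alpha> < \<beta>"
  shows "\<exists>\<omega> > m_star g F a. \<forall>n0 n1. 0 < n0 \<and> n0 < m_star g F a \<and> \<omega> < n1 \<longrightarrow>
    (let X = planar_field g (stepwise_weight \<alpha> \<beta> n0 n1) F;
         \<psi> = poincare_map X \<beta>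
     in \<exists>\<Lambda> h. compact \<Lambda> \<and> \<Lambda> \<subseteq> {a<..<1} \<times> {0<..} \<and>
          \<Lambda> \<subseteq> poincare_dom X \<beta> \<and> \<psi> ` \<Lambda> = \<Lambda> \<and>
          semiconjugate_via \<Lambda> \<psi> h two_symbol_seqs bernoulli_shift \<and>
          (\<forall>i\<in>two_symbol_seqs. periodic_seq i \<longrightarrow>
             (\<exists>z\<in>\<Lambda>. periodic_point \<psi> z \<and> h z = i)))"
proof -
  obtain L where L: "0 < L" "\<And>s t. \<bar>s\<bar> \<le> 1 \<Longrightarrow> \<bar>t\<bar> \<le> 1 \<Longrightarrow> \<bar>F s - F t\<bar> \<le> L * \<bar>s - t\<bar>"
    using C1_lipschitz_on_bounded[OF assms(2)] by blast
  have cF: "continuous_on UNIV F"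
    using assms(2) C1_differentiable_imp_continuous_on by blast
  interpret nagumo g a L F
    by unfold_locales (use assms cF L in auto)
  define M where "M = (SUP s\<in>{a..1}. F s / s)"
  have bdd: "bdd_above ((\<lambda>s. F s / s) ` {a..1})"
    using a by (intro bounded_imp_bdd_above compact_imp_bounded compact_continuous_image continuous_intros) auto
  have M_ge: "F s / s \<le> M" if "s \<in> {a..1}" for s
    unfolding M_def by (rule cSUP_upper[OF that bdd])
  have "0 < F ((a + 1) / 2) / ((a + 1) / 2)" using F_pos[of "(a + 1) / 2"] a by (intro divide_pos_pos) auto
  also have "\<dots> \<le> M" using a by (intro M_ge) auto
  finally have M: "0 < M" .
  define ms where "ms = m_star g F a"
  have ms: "ms = g / M" "0 < ms" using g M by (auto simp: ms_def m_star_def M_def)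
  \<comment> \<open>Using \<open>ms\<close> in place of the weak weight makes \<open>k\<close>, and
    with it every later constant and the threshold, valid for all weights between 0 and
    \<open>ms\<close>.\<close>
  define k where "k = g + ms * L"
  have k: "0 \<le> k" using g ms(2) L by (simp add: k_def add_nonneg_nonneg)
  have weak: "0 \<le> g * s - m * F s \<and> g * s - m * F s \<le> k * s" if m: "0 < m" "m < ms" and s: "s \<in> {0..1}" for m s
  proof
    \<comment> \<open>Left of \<open>a\<close> the term - m F s is nonnegative. From
      \<open>a\<close> on, the maximum M of F s / s gives m F s <= m M s <= g s, the last step being
      m < g / M.\<close>
    show "0 \<le> g * s - m * F s"
    proof (cases "s < a")
      case True
      then have "m * F s \<le> 0" using F_neg[of s] F_zero s m by (cases "s = 0") (auto simp: mult_le_0_iff)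
      moreover have "0 \<le> g * s" using g s by auto
      ultimately show ?thesis by linarith
    next
      case False
      then have "F s \<le> M * s" using M_ge[of s] s a by (auto simp: field_simps)
      then have "m * F s \<le> m * (M * s)" using m by simp
      also have "\<dots> = (m * M) * s" by simp
      also have "\<dots> \<le> g * s" using m(2) M s unfolding ms(1) by (intro mult_right_mono) (auto simp: field_simps)
      finally show ?thesis by simp
    qed
    have "- F s \<le> L * s" using F_lipschitz[of s 0] s F_zero by auto
    then have "m * (- F s) \<le> m * (L * s)" using m by (intro mult_left_mono) auto
    also have "\<dots> \<le> ms * (L * s)" using m L s by (intro mult_right_mono) auto
    finally show "g * s - m * F s \<le> k * s" by (simp add: k_def algebra_simps)
  qed
  define T where "T = \<beta> - \<alpha>"
  have T: "0 < T" "\<beta> = \<alpha> + T" using assms by (auto simp: T_def)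
  \<comment> \<open>The largest resting position that the growth factor exp((1 + k) T) cannot carry
    past \<open>a\<close>.\<close>
  define \<delta> where "\<delta> = a * exp (- ((1 + k) * T))"
  have \<delta>: "0 < \<delta>" "\<delta> * exp ((1 + k) * T) = a" using a by (simp_all add: \<delta>_def exp_minus)
  have "\<delta> < a"
  proof -
    have "0 < (1 + k) * T" using T k by (simp add: add_pos_nonneg)
    then show ?thesis using a by (simp add: \<delta>_def)
  qed
  \<comment> \<open>Continuity of \<open>prim\<close> supplies the sides: \<open>cm\<close> near a
    because prim a < prim \<delta>, and \<open>cp\<close> near 1 because prim 1 > 0.\<close>
  have lim: "(prim \<longlongrightarrow> prim x) (at x within S)" for x S
    using DERIV_isCont[OF prim(2)] by (meson continuous_at_imp_continuous_within continuous_within)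
  have "\<forall>\<^sub>F x in at_right a. prim x < prim \<delta>"
    by (rule order_tendstoD(2)[OF lim]) (use prim_decreasing[of \<delta> a] \<delta>(1) \<open>\<delta> < a\<close> in auto)
  moreover have "\<forall>\<^sub>F x in at_right a. x \<in> {a<..<1}" by (rule eventually_at_right_real) (rule a)
  ultimately have "\<forall>\<^sub>F x in at_right a. prim x < prim \<delta> \<and> a < x \<and> x < 1"
    by eventually_elim auto
  then obtain cm where cm: "prim cm < prim \<delta>" "a < cm" "cm < 1"
    using eventually_happens'[OF trivial_limit_at_right_real] by blast
  have "\<forall>\<^sub>F x in at_left 1. 0 < prim x"
    by (rule order_tendstoD(1)[OF lim prim_one])
  moreover have "\<forall>\<^sub>F x in at_left 1. x \<in> {cm<..<1}" by (rule eventually_at_left_real) (rule cm)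
  ultimately have "\<forall>\<^sub>F x in at_left 1. 0 < prim x \<and> cm < x \<and> x < 1"
    by eventually_elim auto
  then obtain cp where cp: "0 < prim cp" "cm < cp" "cp < 1"
    using eventually_happens'[OF trivial_limit_at_left_real] by blast
  \<comment> \<open>The numerator of the angular velocity on the inner level as \<epsilon> tends to
    0, with the maximum because w^2 cannot be negative. It is positive on the compact interval: off
    \<open>a\<close> by the sign of (v - a) F v, as 0 and 1 are excluded, and at \<open>a\<close> by
    the first summand.\<close>
  define q where "q v = max 0 (2 * (prim \<delta> - prim v)) + (v - a) * F v" for v
  have q_pos: "0 < q v" if "v \<in> {\<delta> / 2..cp}" for v
  proof (cases v a rule: linorder_cases)
    case less
    then have "0 < (v - a) * F v" using F_neg[of v] that \<delta>(1) by (intro mult_neg_neg) auto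
    then show ?thesis by (simp add: q_def add_nonneg_pos)
  next
    case equal
    then show ?thesis using prim_decreasing[of \<delta> a] \<delta>(1) \<open>\<delta> < a\<close> by (simp add: q_def)
  next
    case greater
    then have "0 < (v - a) * F v" using F_pos[of v] that cp by (intro mult_pos_pos) auto
    then show ?thesis by (simp add: q_def add_nonneg_pos)
  qed
  have "continuous_on {\<delta> / 2..cp} q" unfolding q_def by (intro continuous_intros)
  then obtain v0 where v0: "v0 \<in> {\<delta> / 2..cp}" "\<And>v. v \<in> {\<delta> / 2..cp} \<Longrightarrow> q v0 \<le> q v"
    using continuous_attains_inf[of "{\<delta> / 2..cp}" q] \<delta>(1) \<open>\<delta> < a\<close> cm cp by auto
  define \<mu> where "\<mu> = q v0 / 2"
  have \<mu>: "0 < \<mu>" "\<And>v. v \<in> {\<delta> / 2..cp} \<Longrightarrow> 2 * \<mu> \<le> max 0 (2 * (prim \<delta> - prim v)) + (v - a) * F v"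
    using q_pos[OF v0(1)] v0(2) unfolding q_def[symmetric] by (simp_all add: \<mu>_def)
  \<comment> \<open>In order: the left side is inside the inner level; the right side is outside the
    loop; the inner level stays right of \<delta>/2; g / n is small against \<mu>; the speed at v =
    a is at least 1/T. The condition with the square root, below, makes the inner level turn by more
    than 4 pi.\<close>
  have "\<forall>\<^sub>F n in at_top. (1 / T + k * T)\<^sup>2 / 2 + g < n * (prim \<delta> - prim cm)"
    "\<forall>\<^sub>F n in at_top. g < n * prim cp" "\<forall>\<^sub>F n in at_top. g < n * (prim (\<delta> / 2) - prim \<delta>)"
    "\<forall>\<^sub>F n in at_top. 2 * g < n * \<mu>" "\<forall>\<^sub>F n in at_top. 1 < n * (2 * (prim \<delta> - prim a) * T\<^sup>2)"
    using cm cp prim_decreasing[of "\<delta> / 2" \<delta>] prim_decreasing[of \<delta> a] \<delta>(1) \<open>\<delta> < a\<close> \<mu>(1) T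
    by (auto intro!: eventually_less_mult)
  moreover have "\<forall>\<^sub>F n in at_top. 4 * pi * (2 - 2 * prim a) < sqrt n * (\<alpha> * \<mu>)"
    by (rule eventually_compose_filterlim[OF eventually_less_mult sqrt_at_top]) (use assms \<mu> in auto)
  moreover have "\<forall>\<^sub>F n in at_top. max g 1 \<le> n" by (rule eventually_ge_at_top)
  ultimately have "\<forall>\<^sub>F n in at_top. (1 / T + k * T)\<^sup>2 / 2 + g < n * (prim \<delta> - prim cm) \<and>
      g < n * prim cp \<and> g < n * (prim (\<delta> / 2) - prim \<delta>) \<and> 2 * g < n * \<mu> \<and>
      1 < n * (2 * (prim \<delta> - prim a) * T\<^sup>2) \<and>
      4 * pi * (2 - 2 * prim a) < sqrt n * (\<alpha> * \<mu>) \<and> max g 1 \<le> n"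
    by (intro eventually_conj)
  then obtain N where N: "\<And>n. N \<le> n \<Longrightarrow> (1 / T + k * T)\<^sup>2 / 2 + g < n * (prim \<delta> - prim cm) \<and>
      g < n * prim cp \<and> g < n * (prim (\<delta> / 2) - prim \<delta>) \<and> 2 * g < n * \<mu> \<and>
      1 < n * (2 * (prim \<delta> - prim a) * T\<^sup>2) \<and>
      4 * pi * (2 - 2 * prim a) < sqrt n * (\<alpha> * \<mu>) \<and> max g 1 \<le> n"
    unfolding eventually_at_top_linorder by blast
  show ?thesis
    unfolding Let_def
  \<comment> \<open>The entry \<open>ms + 1\<close> puts the threshold strictly above
    \<open>m_star\<close>.\<close>
  proof (intro exI[of _ "max N (ms + 1)"] conjI allI impI)
    show "max N (ms + 1) > m_star g F a" by (simp add: ms_def)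
    fix n0 n1 assume n: "0 < n0 \<and> n0 < m_star g F a \<and> max N (ms + 1) < n1"
    then have n0: "0 < n0" "n0 < ms" and n1: "N \<le> n1" by (auto simp: ms_def)
    from N[OF n1] have large: "(1 / T + k * T)\<^sup>2 / 2 + g < n1 * (prim \<delta> - prim cm)" "g < n1 * prim cp"
      "g < n1 * (prim (\<delta> / 2) - prim \<delta>)" "4 * pi * (2 - 2 * prim a) < sqrt n1 * (\<alpha> * \<mu>)"
      by blast+
    from N[OF n1] have "2 * g < n1 * \<mu>" "1 < n1 * (2 * (prim \<delta> - prim a) * T\<^sup>2)" "max g 1 \<le> n1"
      by blast+
    then have large': "2 * g \<le> n1 * \<mu>" "1 \<le> n1 * (2 * (prim \<delta> - prim a) * T\<^sup>2)" "g \<le> n1" "0 < n1"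
      by linarith+
    interpret twist g a L F \<alpha> T k \<delta> cm cp \<mu> n1 n0
      by unfold_locales
        (fact assms(15) T(1) k cm(1,2) cp(2,3) \<delta>(1) eq_refl[OF \<delta>(2)] \<mu> large large'
          less_imp_le[OF n0(1)] weak[OF n0])+
    show "\<exists>\<Lambda> h. compact \<Lambda> \<and> \<Lambda> \<subseteq> {a<..<1} \<times> {0<..} \<and>
          \<Lambda> \<subseteq> poincare_dom (planar_field g (stepwise_weight \<alpha> \<beta> n0 n1) F) \<beta> \<and>
          poincare_map (planar_field g (stepwise_weight \<alpha> \<beta> n0 n1) F) \<beta> ` \<Lambda> = \<Lambda> \<and>
          semiconjugate_via \<Lambda> (poincare_map (planar_field g (stepwise_weight \<alpha> \<beta> n0 n1) F) \<beta>) h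
            two_symbol_seqs bernoulli_shift \<and>
          (\<forall>i\<in>two_symbol_seqs. periodic_seq i \<longrightarrow>
             (\<exists>z\<in>\<Lambda>. periodic_point (poincare_map (planar_field g (stepwise_weight \<alpha> \<beta> n0 n1) F) \<beta>) z \<and> h z = i))"
      unfolding T(2) by (rule twist_horseshoe[OF assms(2) refl])
  qed
qed

end
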